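(* For each non-basic $(\Gamma,G)\in\mathcal{OG}(4)$, there is at least one normal subgroup $N$ of $G$ such that $\Gamma$ is a $G$-normal cover of the quotient $\Gamma_N$, $(\Gamma_N,G/N)\in\mathcal{OG}(4)$, and $(\Gamma_N,G/N)$ is basic.
   Context: All graphs are finite, simple and undirected. $\mathcal{OG}(4)$ is the set of pairs $(\Gamma,G)$ where $\Gamma$ is a connected graph of valency $4$ with vertex set $X$, and $G\leq\mathrm{Aut}(\Gamma)$ is transitive on $X$ and on edges, and $\Gamma$ is $G$-oriented: there is a $G$-orbit $\Delta\subset X\times X$, disjoint from $\Delta^*=\{(y,x)\mid (x,y)\in\Delta\}$, such that the edges of $\Gamma$ are exactly the pairs $\{x,y\}$ with $(x,y)\in\Delta$ or $(y,x)\in\Delta$. For $N\trianglelefteq G$, the $G$-normal quotient $\Gamma_N$ is the graph whose vertices are the $N$-orbits in $X$, with distinct $N$-orbits $B,C$ adjacent if and only if there is an edge $\{x,y\}$ of $\Gamma$ with $x\in B$, $y\in C$; $\overline{G}$ is the permutation group induced by $G$ on the set of $N$-orbits. Writing $(\Gamma_N,G/N)\in\mathcal{OG}(4)$ includes the assertion that $\overline{G}=G/N$, i.e. $G/N$ acts faithfully on the $N$-orbits. $\Gamma$ is a $G$-normal $\ell$-multicover of $\Gamma_N$ if, for each edge $\{B,C\}$ of $\Gamma_N$, each vertex of $B$ is joined by an edge of $\Gamma$ to exactly $\ell$ vertices of $C$; a $G$-normal cover is the case $\ell=1$. A pair $(\Gamma_N,\overline{G})$ is called degenerate if it is one of: $(K_1,1)$;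 $(K_2,Z_2)$ (with $\Gamma$ bipartite and the $N$-orbits forming the bipartition); $(C_r,D_{2r})$ or $(C_r,Z_r)$ with $r\geq3$ (with $\Gamma$ a $G$-normal $2$-multicover of $\Gamma_N$). Here $C_r$ is the cycle on $r$ vertices and $D_{2r}$ is dihedral of order $2r$. A pair $(\Gamma,G)\in\mathcal{OG}(4)$ is basic if $(\Gamma_N,\overline{G})$ is degenerate for every nontrivial normal subgroup $N$ of $G$. *)

theory Defs
  imports "HOL-Algebra.Group_Action"
begin

section \<open>Graphs and permutation groups\<close>

text \<open>A graph is given by its vertex set \<open>X\<close> and its edge set \<open>E\<close>, whose members are
  two-element subsets of \<open>X\<close>.\<close>

definition finite_simple_graph :: "'a set \<Rightarrow> 'a set set \<Rightarrow> bool" where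
  "finite_simple_graph X E \<longleftrightarrow>
     finite X \<and> (\<forall>e\<in>E. \<exists>x\<in>X. \<exists>y\<in>X. x \<noteq> y \<and> e = {x, y})"

definition connected_graph :: "'a set \<Rightarrow> 'a set set \<Rightarrow> bool" where
  "connected_graph X E \<longleftrightarrow>
     X \<noteq> {} \<and> (\<forall>x\<in>X. \<forall>y\<in>X. (x, y) \<in> {(u, v). {u, v} \<in> E}\<^sup>*)"

definition regular_graph :: "'a set \<Rightarrow> 'a set set \<Rightarrow> nat \<Rightarrow> bool" where
  "regular_graph X E k \<longleftrightarrow> (\<forall>x\<in>X. card {y\<in>X. {x, y} \<in> E} = k)"

definition graph_aut :: "'a set \<Rightarrow> 'a set set \<Rightarrow> ('a \<Rightarrow> 'a) set" where
  "graph_aut X E = {g \<in> Bij X. \<forall>x\<in>X. \<forall>y\<in>X. {g x, g y} \<in> E \<longleftrightarrow> {x, y} \<in> E}"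

text \<open>As in \<^const>\<open>BijGroup\<close>, permutations of \<open>X\<close> are extensional functions, i.e. they are
  \<^const>\<open>undefined\<close> outside \<open>X\<close>.  The following is the group structure on a subgroup \<open>G\<close>
  of the symmetric group on \<open>X\<close>.\<close>

definition perm_group :: "'a set \<Rightarrow> ('a \<Rightarrow> 'a) set \<Rightarrow> ('a \<Rightarrow> 'a) monoid" where
  "perm_group X G = (BijGroup X)\<lparr>carrier := G\<rparr>"

definition oriented_graph :: "'a set \<Rightarrow> 'a set set \<Rightarrow> ('a \<Rightarrow> 'a) set \<Rightarrow> bool" where
  "oriented_graph X E G \<longleftrightarrow>
     (\<exists>\<Delta> \<in> orbits (perm_group X G) (X \<times> X) (\<lambda>g. map_prod g g).
        \<Delta> \<inter> \<Delta>\<inverse> = {} \<and> E = {{x, y} | x y. (x, y) \<in> \<Delta> \<or> (y, x) \<in> \<Delta>})"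

definition OG4 :: "'a set \<Rightarrow> 'a set set \<Rightarrow> ('a \<Rightarrow> 'a) set \<Rightarrow> bool" where
  "OG4 X E G \<longleftrightarrow>
     finite_simple_graph X E \<and> connected_graph X E \<and> regular_graph X E 4 \<and>
     subgroup G (BijGroup X) \<and> G \<subseteq> graph_aut X E \<and>
     (\<forall>x\<in>X. \<forall>y\<in>X. \<exists>g\<in>G. g x = y) \<and>
     (\<forall>e\<in>E. \<forall>f\<in>E. \<exists>g\<in>G. g ` e = f) \<and>
     oriented_graph X E G"


section \<open>Normal quotients\<close>

definition quot_verts :: "'a set \<Rightarrow> ('a \<Rightarrow> 'a) set \<Rightarrow> 'a set set" where
  "quot_verts X N = orbits (perm_group X N) X (\<lambda>g. g)"

definition quot_edges :: "'a set \<Rightarrow> 'a set set \<Rightarrow> ('a \<Rightarrow> 'a) set \<Rightarrow> 'a set set set" where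
  "quot_edges X E N =
     {{B, C} | B C. B \<in> quot_verts X N \<and> C \<in> quot_verts X N \<and> B \<noteq> C \<and>
                    (\<exists>x\<in>B. \<exists>y\<in>C. {x, y} \<in> E)}"

text \<open>The permutation group induced by \<open>G\<close> on the set of \<open>N\<close>-orbits.\<close>

definition quot_group ::
    "'a set \<Rightarrow> ('a \<Rightarrow> 'a) set \<Rightarrow> ('a \<Rightarrow> 'a) set \<Rightarrow> ('a set \<Rightarrow> 'a set) set" where
  "quot_group X G N = (\<lambda>g. \<lambda>B \<in> quot_verts X N. g ` B) ` G"

text \<open>The action of the factor group \<open>G/N\<close> on the \<open>N\<close>-orbits.  For a coset \<open>c = Ng\<close>, every
  member of \<open>c\<close> maps the orbit \<open>B\<close> to the same orbit, which is therefore the union below.\<close>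

definition coset_action ::
    "'a set \<Rightarrow> ('a \<Rightarrow> 'a) set \<Rightarrow> ('a \<Rightarrow> 'a) set \<Rightarrow> 'a set \<Rightarrow> 'a set" where
  "coset_action X N c = (\<lambda>B \<in> quot_verts X N. \<Union>g\<in>c. g ` B)"

definition quotient_in_OG4 ::
    "'a set \<Rightarrow> 'a set set \<Rightarrow> ('a \<Rightarrow> 'a) set \<Rightarrow> ('a \<Rightarrow> 'a) set \<Rightarrow> bool" where
  "quotient_in_OG4 X E G N \<longleftrightarrow>
     OG4 (quot_verts X N) (quot_edges X E N) (quot_group X G N) \<and>
     faithful_action (perm_group X G Mod N) (quot_verts X N) (coset_action X N)"

definition normal_multicover ::
    "nat \<Rightarrow> 'a set \<Rightarrow> 'a set set \<Rightarrow> ('a \<Rightarrow> 'a) set \<Rightarrow> bool" where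
  "normal_multicover l X E N \<longleftrightarrow>
     (\<forall>B C. {B, C} \<in> quot_edges X E N \<longrightarrow> (\<forall>x\<in>B. card {y\<in>C. {x, y} \<in> E} = l))"

definition normal_cover :: "'a set \<Rightarrow> 'a set set \<Rightarrow> ('a \<Rightarrow> 'a) set \<Rightarrow> bool" where
  "normal_cover X E N \<longleftrightarrow> normal_multicover 1 X E N"


section \<open>Degenerate quotients and basic pairs\<close>

text \<open>Isomorphism of pairs consisting of a graph and a permutation group on its vertices:
  a graph isomorphism which conjugates one permutation group to the other.\<close>

definition pair_iso ::
    "'a set \<Rightarrow> 'a set set \<Rightarrow> ('a \<Rightarrow> 'a) set \<Rightarrow> 'b set \<Rightarrow> 'b set set \<Rightarrow> ('b \<Rightarrow> 'b) set \<Rightarrow> bool" where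
  "pair_iso X E G Y F H \<longleftrightarrow>
     (\<exists>f. bij_betw f X Y \<and> F = (\<lambda>e. f ` e) ` E \<and>
          H = (\<lambda>g. \<lambda>y\<in>Y. f (g (inv_into X f y))) ` G)"

definition complete_edges :: "nat \<Rightarrow> nat set set" where
  "complete_edges n = {{i, j} | i j. i < n \<and> j < n \<and> i \<noteq> j}"

definition cycle_edges :: "nat \<Rightarrow> nat set set" where
  "cycle_edges r = {{i, (i + 1) mod r} | i. i < r}"

text \<open>The standard cyclic group \<open>Z\<^sub>r\<close> and dihedral group \<open>D\<^sub>2\<^sub>r\<close> of permutations of
  \<open>{..<r}\<close>.  The reflections are the maps \<open>i \<mapsto> k - i\<close> modulo \<open>r\<close>.  Note that
  \<open>rotations 1\<close> is the trivial group, and \<open>rotations 2\<close> is generated by a transposition.\<close>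

definition rotations :: "nat \<Rightarrow> (nat \<Rightarrow> nat) set" where
  "rotations r = {\<lambda>i\<in>{..<r}. (i + k) mod r | k. k < r}"

definition dihedral :: "nat \<Rightarrow> (nat \<Rightarrow> nat) set" where
  "dihedral r = rotations r \<union> {\<lambda>i\<in>{..<r}. (k + (r - i)) mod r | k. k < r}"

definition orbits_form_bipartition :: "'a set \<Rightarrow> 'a set set \<Rightarrow> ('a \<Rightarrow> 'a) set \<Rightarrow> bool" where
  "orbits_form_bipartition X E N \<longleftrightarrow>
     (\<exists>B C. quot_verts X N = {B, C} \<and> B \<noteq> C \<and> (\<forall>e\<in>E. \<exists>x\<in>B. \<exists>y\<in>C. e = {x, y}))"

definition degenerate_quotient ::
    "'a set \<Rightarrow> 'a set set \<Rightarrow> ('a \<Rightarrow> 'a) set \<Rightarrow> ('a \<Rightarrow> 'a) set \<Rightarrow> bool" where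
  "degenerate_quotient X E G N \<longleftrightarrow>
     (let quot_iso = pair_iso (quot_verts X N) (quot_edges X E N) (quot_group X G N) in
        quot_iso {..<1} (complete_edges 1) (rotations 1)
      \<or> quot_iso {..<2} (complete_edges 2) (rotations 2) \<and> orbits_form_bipartition X E N
      \<or> (\<exists>r\<ge>3. (quot_iso {..<r} (cycle_edges r) (dihedral r) \<or>
                 quot_iso {..<r} (cycle_edges r) (rotations r)) \<and>
                normal_multicover 2 X E N))"

definition basic_pair :: "'a set \<Rightarrow> 'a set set \<Rightarrow> ('a \<Rightarrow> 'a) set \<Rightarrow> bool" where
  "basic_pair X E G \<longleftrightarrow>
     OG4 X E G \<and>
     (\<forall>N. N \<lhd> perm_group X G \<and> N \<noteq> {\<one>\<^bsub>perm_group X G\<^esub>} \<longrightarrow> degenerate_quotient X E G N)"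

end

theory Submission
  imports Defs
begin

text \<open>
  Call a normal subgroup \<open>N\<close> locally injective if distinct neighbours of a vertex always lie in
  distinct \<open>N\<close>-orbits.  The number \<open>l\<close> of edges from a vertex into an adjacent \<open>N\<close>-orbit is
  constant, so when no edge lies inside an orbit the quotient is regular of valency \<open>4 div l\<close>.
  If \<open>N\<close> is not locally injective, the quotient is therefore a single vertex, a single edge or a
  2-multicovered cycle, hence degenerate.  If it is, \<open>\<Gamma>\<close> is a normal cover of an
  oriented quotient of valency 4, on which \<open>G/N\<close> is faithful because a covering transformation
  fixing all orbits and agreeing with some \<open>n \<in> N\<close> at one vertex equals \<open>n\<close>.

  Take \<open>N\<close> locally injective of maximal order; one exists because the pair is not basic.  A
  nontrivial non-degenerate normal subgroup of the quotient group would be locally injective on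
  the quotient, and its preimage in \<open>G\<close> a larger locally injective normal subgroup.
\<close>

section \<open>Permutation groups\<close>

locale perm_grp =
  fixes X :: "'a set" and G :: "('a \<Rightarrow> 'a) set"
  assumes subgroup_Bij: "subgroup G (BijGroup X)"
begin

lemma in_Bij: "g \<in> G \<Longrightarrow> g \<in> Bij X"
  using subgroup.subset[OF subgroup_Bij] by (auto simp: BijGroup_def)

lemma bij: "g \<in> G \<Longrightarrow> bij_betw g X X"
  using in_Bij by (auto simp: Bij_def)

lemma closed [simp]: "g \<in> G \<Longrightarrow> x \<in> X \<Longrightarrow> g x \<in> X"
  using bij by (auto simp: bij_betw_def)

lemma inj: "g \<in> G \<Longrightarrow> inj_on g X"
  using bij by (auto simp: bij_betw_def)

lemma eq_iff [simp]: "g \<in> G \<Longrightarrow> x \<in> X \<Longrightarrow> y \<in> X \<Longrightarrow> g x = g y \<longleftrightarrow> x = y"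
  using inj by (auto dest: inj_onD)

lemma ext: "g \<in> G \<Longrightarrow> h \<in> G \<Longrightarrow> (\<And>x. x \<in> X \<Longrightarrow> g x = h x) \<Longrightarrow> g = h"
  using in_Bij by (meson Bij_imp_extensional extensionalityI)

lemma id_in: "(\<lambda>x\<in>X. x) \<in> G"
  using subgroup.one_closed[OF subgroup_Bij] by (simp add: BijGroup_def)

lemma compose_in: "g \<in> G \<Longrightarrow> h \<in> G \<Longrightarrow> compose X g h \<in> G"
  using subgroup.m_closed[OF subgroup_Bij, of g h] in_Bij by (simp add: BijGroup_def)

lemma inv_in: "g \<in> G \<Longrightarrow> restrict (inv_into X g) X \<in> G"
  using subgroup.m_inv_closed[OF subgroup_Bij, of g] in_Bij by (simp add: inv_BijGroup)

lemma ex_inv: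
  assumes "g \<in> G"
  obtains k where "k \<in> G" "\<And>x. x \<in> X \<Longrightarrow> k (g x) = x" "\<And>x. x \<in> X \<Longrightarrow> g (k x) = x"
proof (rule that[OF inv_in[OF assms]])
  fix x assume x: "x \<in> X"
  show "restrict (inv_into X g) X (g x) = x"
    using assms x inj by simp
  show "g (restrict (inv_into X g) X x) = x"
    using bij_betw_inv_into_right[OF bij[OF assms] x] x by simp
qed

text \<open>Permutations are extensional here, so \<open>G\<close> lies in the extensional function
  space from \<open>X\<close> to \<open>X\<close>, which is finite.\<close>

lemma finite_grp: "finite X \<Longrightarrow> finite G"
proof (rule finite_subset)
  show "G \<subseteq> X \<rightarrow>\<^sub>E X"
    using in_Bij Bij_imp_extensional by (auto simp: PiE_def)
qed (auto intro: finite_PiE)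

lemma carrier_perm [simp]: "carrier (perm_group X G) = G"
  by (simp add: perm_group_def)

lemma group_perm: "group (perm_group X G)"
  unfolding perm_group_def
  by (rule subgroup.subgroup_is_group[OF subgroup_Bij group_BijGroup])

lemma mult_perm: "g \<in> G \<Longrightarrow> h \<in> G \<Longrightarrow> g \<otimes>\<^bsub>perm_group X G\<^esub> h = compose X g h"
  using in_Bij by (simp add: perm_group_def BijGroup_def)

lemma one_perm: "\<one>\<^bsub>perm_group X G\<^esub> = (\<lambda>x\<in>X. x)"
  by (simp add: perm_group_def BijGroup_def)

lemma inv_perm: "g \<in> G \<Longrightarrow> inv\<^bsub>perm_group X G\<^esub> g = restrict (inv_into X g) X"
  using group.m_inv_consistent[OF group_BijGroup subgroup_Bij, of g] in_Bij
  by (simp add: perm_group_def inv_BijGroup)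

end

text \<open>Left inverses on the points of \<open>X\<close> suffice: such a \<open>k\<close> must be
  the group inverse in \<open>BijGroup X\<close>, where inverses are unique.\<close>

lemma perm_grpI:
  assumes "G \<subseteq> Bij X" "(\<lambda>x\<in>X. x) \<in> G"
    and "\<And>g h. g \<in> G \<Longrightarrow> h \<in> G \<Longrightarrow> compose X g h \<in> G"
    and "\<And>g. g \<in> G \<Longrightarrow> \<exists>k\<in>G. \<forall>x\<in>X. k (g x) = x"
  shows "perm_grp X G"
proof (rule perm_grp.intro)
  have inv: "inv\<^bsub>BijGroup X\<^esub> g \<in> G" if g: "g \<in> G" for g
  proof -
    obtain k where k: "k \<in> G" "\<forall>x\<in>X. k (g x) = x" using assms(4)[OF g] by blast
    have "k \<otimes>\<^bsub>BijGroup X\<^esub> g = \<one>\<^bsub>BijGroup X\<^esub>"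
      using k g assms(1) by (auto simp: BijGroup_def compose_def)
    moreover have "k \<in> carrier (BijGroup X)" "g \<in> carrier (BijGroup X)"
      using k g assms(1) by (auto simp: BijGroup_def)
    ultimately show ?thesis
      using group.inv_equality[OF group_BijGroup] k(1) by metis
  qed
  show "subgroup G (BijGroup X)"
    by (rule group.subgroupI[OF group_BijGroup])
      (use assms inv in \<open>auto simp: BijGroup_def subset_iff\<close>)
qed

section \<open>Orbits of a normal subgroup\<close>

definition orb :: "('a \<Rightarrow> 'a) set \<Rightarrow> 'a \<Rightarrow> 'a set" where
  "orb N x = (\<lambda>n. n x) ` N"

locale normal_perm = perm_grp +
  fixes N :: "('a \<Rightarrow> 'a) set"
  assumes normal: "N \<lhd> perm_group X G"
begin

lemma N_subset: "N \<subseteq> G"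
  using normal_imp_subgroup[OF normal] subgroup.subset by fastforce

lemma N_in_G [simp]: "n \<in> N \<Longrightarrow> n \<in> G"
  using N_subset by auto

sublocale N: perm_grp X N
proof (rule perm_grp.intro)
  have "subgroup N (perm_group X G)" by (rule normal_imp_subgroup[OF normal])
  then show "subgroup N (BijGroup X)"
    using group.incl_subgroup[OF group_BijGroup subgroup_Bij] by (simp add: perm_group_def)
qed

lemma quot_verts_eq: "quot_verts X N = orb N ` X"
  by (auto simp: quot_verts_def orbits_def orbit_def orb_def perm_group_def)

text \<open>The element \<open>m\<close> is the conjugate of \<open>n\<close> by \<open>g\<close>,
  described by its values instead of by \<open>inv_into\<close>.\<close>

lemma conj:
  assumes "g \<in> G" "n \<in> N"
  obtains m where "m \<in> N" "\<And>x. x \<in> X \<Longrightarrow> m (g x) = g (n x)"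
proof -
  have g: "restrict (inv_into X g) X \<in> G" using inv_in assms by simp
  let ?P = "perm_group X G"
  have "g \<otimes>\<^bsub>?P\<^esub> n \<otimes>\<^bsub>?P\<^esub> inv\<^bsub>?P\<^esub> g \<in> N"
    using normal.inv_op_closed2[OF normal] assms by simp
  then have "compose X (compose X g n) (restrict (inv_into X g) X) \<in> N"
    using assms g compose_in by (simp add: mult_perm inv_perm)
  moreover have "compose X (compose X g n) (restrict (inv_into X g) X) (g x) = g (n x)" if "x \<in> X" for x
    using that assms inj by (simp add: compose_def)
  ultimately show thesis using that by blast
qed

text \<open>This is \<open>conj\<close> for the inverse \<open>k\<close> of \<open>g\<close>, so
  \<open>m\<close> is the conjugate of \<open>n\<close> by \<open>k\<close>.\<close>

lemma conj':
  assumes "g \<in> G" "n \<in> N"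
  obtains m where "m \<in> N" "\<And>x. x \<in> X \<Longrightarrow> n (g x) = g (m x)"
proof -
  obtain k where k: "k \<in> G" "\<And>x. x \<in> X \<Longrightarrow> k (g x) = x" "\<And>x. x \<in> X \<Longrightarrow> g (k x) = x"
    using ex_inv[OF assms(1)] by blast
  obtain m where m: "m \<in> N" "\<And>x. x \<in> X \<Longrightarrow> m (k x) = k (n x)"
    using conj[OF k(1) assms(2)] by blast
  have "n (g x) = g (m x)" if "x \<in> X" for x
    using m(2)[of "g x"] k that assms m(1) by simp
  then show thesis using m(1) that by blast
qed

lemma orb_self [simp]: "x \<in> X \<Longrightarrow> x \<in> orb N x"
  unfolding orb_def by (rule image_eqI[OF _ N.id_in]) simp

lemma orb_subset: "x \<in> X \<Longrightarrow> orb N x \<subseteq> X"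
  by (auto simp: orb_def)

lemma orb_in: "y \<in> orb N x \<Longrightarrow> x \<in> X \<Longrightarrow> y \<in> X"
  using orb_subset by auto

lemma orb_n [simp]: "n \<in> N \<Longrightarrow> x \<in> X \<Longrightarrow> orb N (n x) = orb N x"
proof (intro equalityI subsetI)
  fix y assume n: "n \<in> N" "x \<in> X" and "y \<in> orb N (n x)"
    then obtain m where m: "m \<in> N" "y = m (n x)" by (auto simp: orb_def)
    then have "y = compose X m n x" using n by (simp add: compose_def)
    then show "y \<in> orb N x" using n m N.compose_in by (auto simp: orb_def)
next
  fix y assume n: "n \<in> N" "x \<in> X" and "y \<in> orb N x"
    then obtain m where m: "m \<in> N" "y = m x" by (auto simp: orb_def)
    obtain k where k: "k \<in> N" "k (n x) = x" using N.ex_inv[OF n(1)] n(2) by metis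
    then have "y = compose X m k (n x)" using m n by (simp add: compose_def)
    then show "y \<in> orb N (n x)" using k m N.compose_in by (auto simp: orb_def)
qed

lemma orb_eq: "y \<in> orb N x \<Longrightarrow> x \<in> X \<Longrightarrow> orb N y = orb N x"
proof -
  assume "y \<in> orb N x" and x: "x \<in> X"
  then obtain n where "n \<in> N" "y = n x" unfolding orb_def by blast
  then show ?thesis using orb_n x by simp
qed

lemma orb_eq_iff: "x \<in> X \<Longrightarrow> y \<in> X \<Longrightarrow> orb N y = orb N x \<longleftrightarrow> y \<in> orb N x"
  using orb_eq orb_self by blast

lemma orb_eqD: "x \<in> X \<Longrightarrow> y \<in> X \<Longrightarrow> orb N y = orb N x \<Longrightarrow> \<exists>n\<in>N. y = n x"
  using orb_eq_iff[of x y] unfolding orb_def by blast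

text \<open>Normality makes the orbits blocks for \<open>G\<close>; the two inclusions come from
  \<open>conj\<close> and \<open>conj'\<close> respectively.\<close>

lemma image_orb: "g \<in> G \<Longrightarrow> x \<in> X \<Longrightarrow> g ` orb N x = orb N (g x)"
proof (intro equalityI subsetI)
  fix y assume g: "g \<in> G" "x \<in> X" and "y \<in> g ` orb N x"
  then obtain n where n: "n \<in> N" "y = g (n x)" unfolding orb_def by blast
  obtain m where "m \<in> N" "m (g x) = g (n x)" using conj[OF g(1) n(1)] g(2) by metis
  then show "y \<in> orb N (g x)" using n unfolding orb_def by (metis image_eqI)
next
  fix y assume g: "g \<in> G" "x \<in> X" and "y \<in> orb N (g x)"
  then obtain n where n: "n \<in> N" "y = n (g x)" unfolding orb_def by blast
  obtain m where "m \<in> N" "n (g x) = g (m x)" using conj'[OF g(1) n(1)] g(2) by metis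
  then show "y \<in> g ` orb N x" using n unfolding orb_def by blast
qed

section \<open>The group induced on the orbits\<close>

definition qact :: "('a \<Rightarrow> 'a) \<Rightarrow> 'a set \<Rightarrow> 'a set" where
  "qact g = (\<lambda>B \<in> quot_verts X N. g ` B)"

lemma quot_group_eq: "quot_group X G N = qact ` G"
  by (simp add: quot_group_def qact_def)

lemma orb_vert [simp]: "x \<in> X \<Longrightarrow> orb N x \<in> quot_verts X N"
  by (simp add: quot_verts_eq)

lemma qact_orb [simp]: "g \<in> G \<Longrightarrow> x \<in> X \<Longrightarrow> qact g (orb N x) = orb N (g x)"
  by (simp add: qact_def image_orb)

lemma vertE:
  assumes "B \<in> quot_verts X N"
  obtains x where "x \<in> X" "B = orb N x"
  using assms by (auto simp: quot_verts_eq)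

lemma qact_ext: "(\<And>x. x \<in> X \<Longrightarrow> orb N (g x) = orb N (h x)) \<Longrightarrow> g \<in> G \<Longrightarrow> h \<in> G \<Longrightarrow> qact g = qact h"
  unfolding qact_def by (rule restrict_ext) (clarsimp simp: quot_verts_eq image_orb)

lemma qact_Bij: "g \<in> G \<Longrightarrow> qact g \<in> Bij (quot_verts X N)"
proof -
  assume g: "g \<in> G"
  obtain k where k: "k \<in> G" "\<And>x. x \<in> X \<Longrightarrow> k (g x) = x" "\<And>x. x \<in> X \<Longrightarrow> g (k x) = x"
    using ex_inv[OF g] by blast
  have "bij_betw (qact g) (quot_verts X N) (quot_verts X N)"
    by (rule bij_betw_byWitness[where f' = "qact k"])
      (use g k in \<open>auto simp: quot_verts_eq\<close>)
  then show ?thesis by (simp add: Bij_def qact_def)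
qed

lemma qact_compose:
  assumes g: "g \<in> G" and h: "h \<in> G"
  shows "qact (compose X g h) = compose (quot_verts X N) (qact g) (qact h)"
proof (rule extensionalityI[where A = "quot_verts X N"])
  fix B assume "B \<in> quot_verts X N"
  then obtain x where x: "x \<in> X" "B = orb N x" by (rule vertE)
  then have "qact (compose X g h) B = orb N (g (h x))"
    using qact_orb[OF compose_in[OF g h]] by (simp add: compose_def)
  moreover have "compose (quot_verts X N) (qact g) (qact h) B = orb N (g (h x))"
    using x g h by (simp add: compose_def)
  ultimately show "qact (compose X g h) B = compose (quot_verts X N) (qact g) (qact h) B"
    by simp
qed (simp_all add: qact_def compose_def)

lemma qact_id: "qact (\<lambda>x\<in>X. x) = (\<lambda>B\<in>quot_verts X N. B)"
proof (rule extensionalityI[where A = "quot_verts X N"])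
  fix B assume "B \<in> quot_verts X N"
  then show "qact (\<lambda>x\<in>X. x) B = (\<lambda>B\<in>quot_verts X N. B) B"
    using qact_orb[OF id_in] by (auto elim: vertE)
qed (simp_all add: qact_def)

text \<open>Closure and inverses are inherited from \<open>G\<close> through \<open>qact\<close>.
  The facts of \<open>perm_grp\<close> thereby become available one level up, for normal subgroups
  of the induced group.\<close>

sublocale Q: perm_grp "quot_verts X N" "quot_group X G N"
proof (rule perm_grpI)
  show "quot_group X G N \<subseteq> Bij (quot_verts X N)"
    using qact_Bij by (auto simp: quot_group_eq)
  show "(\<lambda>B\<in>quot_verts X N. B) \<in> quot_group X G N"
    using id_in qact_id unfolding quot_group_eq by (metis image_eqI)
  fix g h assume "g \<in> quot_group X G N" "h \<in> quot_group X G N"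
  then obtain g' h' where g': "g' \<in> G" "g = qact g'" and h': "h' \<in> G" "h = qact h'"
    unfolding quot_group_eq by blast
  have "compose (quot_verts X N) g h = qact (compose X g' h')"
    using g' h' by (simp add: qact_compose)
  then show "compose (quot_verts X N) g h \<in> quot_group X G N"
    using g'(1) h'(1) compose_in unfolding quot_group_eq by simp
next
  fix g assume "g \<in> quot_group X G N"
  then obtain g' where g': "g' \<in> G" "g = qact g'" by (auto simp: quot_group_eq)
  obtain k where "k \<in> G" "\<And>x. x \<in> X \<Longrightarrow> k (g' x) = x" using ex_inv[OF g'(1)] by blast
  then show "\<exists>k\<in>quot_group X G N. \<forall>B\<in>quot_verts X N. k (g B) = B"
    unfolding quot_group_eq using g'
    by (intro bexI[of _ "qact k"] ballI) (auto elim!: vertE)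
qed

text \<open>Orbits are blocks, so an element of \<open>G\<close> taking a point of \<open>B\<close>
  into \<open>C\<close> maps \<open>B\<close> bijectively onto \<open>C\<close>.\<close>

lemma card_vert:
  assumes tr: "\<forall>x\<in>X. \<forall>y\<in>X. \<exists>g\<in>G. g x = y"
    and "B \<in> quot_verts X N" "C \<in> quot_verts X N"
  shows "card B = card C"
proof -
  obtain x y where xy: "x \<in> X" "y \<in> X" "B = orb N x" "C = orb N y"
    using assms vertE by metis
  obtain g where g: "g \<in> G" "g x = y" using tr xy by blast
  have "inj_on g B" using inj[OF g(1)] xy orb_subset inj_on_subset by blast
  moreover have "g ` B = C" using image_orb g xy by simp
  ultimately show ?thesis using card_image by metis
qed

end

text \<open>The converse of \<open>conj\<close>: a pointwise conjugate \<open>m\<close> is the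
  conjugate in the group, because elements of \<open>G\<close> are determined by their values on
  \<open>X\<close>.\<close>

lemma (in perm_grp) normal_permI:
  assumes N: "perm_grp X N" "N \<subseteq> G"
    and conj: "\<And>g n. g \<in> G \<Longrightarrow> n \<in> N \<Longrightarrow> \<exists>m\<in>N. \<forall>x\<in>X. m (g x) = g (n x)"
  shows "normal_perm X G N"
proof -
  interpret N: perm_grp X N by fact
  have sub: "subgroup N (perm_group X G)"
    using group.subgroup_incl[OF group_BijGroup N.subgroup_Bij subgroup_Bij N(2)]
    by (simp add: perm_group_def)
  have "N \<lhd> perm_group X G"
  proof (rule group.normal_inv_iff[OF group_perm, THEN iffD2], intro conjI ballI sub)
    fix g n assume "g \<in> carrier (perm_group X G)" and n: "n \<in> N"
    then have g: "g \<in> G" by simp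
    then obtain m where m: "m \<in> N" "\<forall>x\<in>X. m (g x) = g (n x)" using conj n by blast
    have i: "restrict (inv_into X g) X \<in> G" using inv_in g by simp
    have "compose X (compose X g n) (restrict (inv_into X g) X) = m"
    proof (rule ext)
      show "compose X (compose X g n) (restrict (inv_into X g) X) \<in> G" "m \<in> G"
        using g n m i N(2) compose_in by auto
      fix x assume x: "x \<in> X"
      have "m (g (inv_into X g x)) = g (n (inv_into X g x))"
        using m(2) i x g closed by fastforce
      then show "compose X (compose X g n) (restrict (inv_into X g) X) x = m x"
        using x closed[OF i] bij_betw_inv_into_right[OF bij[OF g] x] by (simp add: compose_def)
    qed
    then show "g \<otimes>\<^bsub>perm_group X G\<^esub> n \<otimes>\<^bsub>perm_group X G\<^esub> inv\<^bsub>perm_group X G\<^esub> g \<in> N"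
      using g n m i N(2) compose_in by (auto simp: mult_perm inv_perm subset_iff)
  qed
  then show ?thesis
    by (intro normal_perm.intro normal_perm_axioms.intro perm_grp.intro subgroup_Bij)
qed

section \<open>Cycles\<close>

text \<open>The main form in which connectedness is used: \<open>S\<close> will be the range of a
  walk, a set of orbits, or the set of points where two permutations agree.\<close>

lemma connected_closed:
  assumes "connected_graph X E" "v \<in> X" "v \<in> S"
    and closed: "\<And>x y. x \<in> S \<Longrightarrow> {x, y} \<in> E \<Longrightarrow> y \<in> S"
  shows "X \<subseteq> S"
proof
  fix y assume "y \<in> X"
  then have "(v, y) \<in> {(u, v). {u, v} \<in> E}\<^sup>*"
    using assms by (auto simp: connected_graph_def)
  then show "y \<in> S"
  proof induction
    case (step y z)
    then show ?case using closed[of y z] by blast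
  qed fact
qed

text \<open>The iterate \<open>h ^^ k\<close> need not be extensional, so the element of
  \<open>G\<close> is only required to agree with it on \<open>X\<close>.\<close>

lemma (in perm_grp) funpow_in:
  assumes "h \<in> G"
  obtains g where "g \<in> G" "\<And>x. x \<in> X \<Longrightarrow> g x = (h ^^ k) x"
proof -
  have "\<exists>g\<in>G. \<forall>x\<in>X. g x = (h ^^ k) x"
  proof (induction k)
    case 0
    show ?case by (rule bexI[OF _ id_in]) simp
  next
    case (Suc k)
    then obtain g where "g \<in> G" "\<forall>x\<in>X. g x = (h ^^ k) x" by blast
    then show ?case
      using compose_in[OF assms, of g] by (intro bexI[of _ "compose X h g"]) (auto simp: compose_def)
  qed
  then show thesis using that by blast
qed

text \<open>The element \<open>h\<close> moves \<open>v\<close> along an edge, and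
  \<open>hhv\<close> says that it does not turn back. In a connected graph of valency 2 the walk
  \<open>v\<close>, \<open>h v\<close>, \<open>h (h v)\<close>, ... then runs round the whole graph,
  which is a cycle rotated by \<open>h\<close> through one step.\<close>

locale cycle_rotation = perm_grp +
  fixes E :: "'a set set" and v :: 'a and h :: "'a \<Rightarrow> 'a"
  assumes finX: "finite X"
    and edges: "\<And>x y. {x, y} \<in> E \<Longrightarrow> x \<in> X \<and> y \<in> X \<and> x \<noteq> y"
    and pairs: "\<And>e. e \<in> E \<Longrightarrow> \<exists>x y. e = {x, y}"
    and conn: "connected_graph X E"
    and two: "regular_graph X E 2"
    and aut: "\<And>g x y. g \<in> G \<Longrightarrow> {x, y} \<in> E \<Longrightarrow> {g x, g y} \<in> E"
    and v: "v \<in> X" and h: "h \<in> G" and hv: "{v, h v} \<in> E" and hhv: "h (h v) \<noteq> v"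
begin

definition p :: "nat \<Rightarrow> 'a" where "p i = (h ^^ i) v"

lemma p_in [simp]: "p i \<in> X"
  by (induction i) (use v h in \<open>auto simp: p_def\<close>)

lemma p_0: "p 0 = v" and p_Suc: "p (Suc i) = h (p i)"
  by (auto simp: p_def)

lemma p_add: "p (i + j) = (h ^^ i) (p j)"
  by (simp add: p_def funpow_add)

lemma p_edge: "{p i, p (Suc i)} \<in> E"
  by (induction i) (use hv h aut in \<open>auto simp: p_0 p_Suc\<close>)

lemma p_step2: "p (Suc (Suc i)) \<noteq> p i"
  by (induction i) (use hhv h in \<open>auto simp: p_0 p_Suc[of "Suc _"] p_Suc\<close>)

text \<open>The two vertices named are distinct neighbours by \<open>p_step2\<close>, and the
  valency leaves no third. The index \<open>Suc i\<close> guarantees a predecessor on the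
  walk.\<close>

lemma nbrs: "{p (Suc i), y} \<in> E \<longleftrightarrow> y = p i \<or> y = p (Suc (Suc i))"
proof -
  have c: "card {y \<in> X. {p (Suc i), y} \<in> E} = 2"
    using two by (simp add: regular_graph_def)
  have sub: "{p i, p (Suc (Suc i))} \<subseteq> {y \<in> X. {p (Suc i), y} \<in> E}"
    using p_edge[of i] p_edge[of "Suc i"] by (auto simp: insert_commute)
  have "card {p i, p (Suc (Suc i))} = 2"
    using p_step2[of i] by simp
  then have "{p i, p (Suc (Suc i))} = {y \<in> X. {p (Suc i), y} \<in> E}"
    using c sub finX by (intro card_subset_eq) auto
  then show ?thesis using edges by blast
qed

lemma p_cancel: "p (i + j) = p (i + k) \<longleftrightarrow> p j = p k"
  by (induction i) (auto simp: p_Suc h)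

text \<open>Finiteness forces a repetition on the walk, and \<open>p_cancel\<close> shifts it back
  to the starting point.\<close>

lemma p_period: "\<exists>r>0. p r = p 0"
proof -
  have "finite (range p)"
    using finX by (rule finite_subset[rotated]) auto
  then have "\<not> inj p"
    using finite_imageD infinite_UNIV_nat by blast
  then obtain i j where "i < j" "p i = p j"
    unfolding inj_def by (metis linorder_neqE_nat)
  then have "p (i + (j - i)) = p (i + 0)" by simp
  then show ?thesis using \<open>i < j\<close> p_cancel by (metis zero_less_diff)
qed

text \<open>The length of the cycle: by \<open>p_inj\<close> and \<open>p_surj\<close> this least
  period is the number of vertices.\<close>

definition r :: nat where "r = (LEAST r. r > 0 \<and> p r = p 0)"

lemma r: "r > 0" "p r = p 0"
  using LeastI_ex[OF p_period] by (auto simp: r_def)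

lemma r_least: "0 < i \<Longrightarrow> p i = p 0 \<Longrightarrow> r \<le> i"
  by (simp add: r_def Least_le)

lemma p_plus_r [simp]: "p (i + r) = p i"
  using p_cancel[of i r 0] r by simp

lemma p_plus_mult: "p (i + k * r) = p i"
proof (induction k)
  case (Suc k)
  then show ?case using p_plus_r[of "i + k * r"] by (simp add: ac_simps)
qed simp

lemma p_mod: "p (i mod r) = p i"
  by (metis mod_div_mult_eq p_plus_mult)

lemma p_inj: "inj_on p {..<r}"
proof -
  have False if "i < j" "j < r" "p i = p j" for i j
  proof -
    have "p (i + (j - i)) = p (i + 0)" using that by simp
    then show False using r_least[of "j - i"] that unfolding p_cancel by simp
  qed
  then show ?thesis
    by (intro linorder_inj_onI) auto
qed

lemma p_surj: "p ` {..<r} = X"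
proof
  have sub: "X \<subseteq> range p"
  proof (rule connected_closed[OF conn v])
    show "v \<in> range p" using p_0 by (metis rangeI)
    fix x y assume "x \<in> range p" and xy: "{x, y} \<in> E"
    \<comment> \<open>Adding the period gives \<open>x\<close> a positive index, even for
      \<open>i = 0\<close>, so that \<open>nbrs\<close> applies.\<close>
    then obtain i where "x = p (i + r)" by auto
    then have "x = p (Suc (i + r - 1))" using r by simp
    then show "y \<in> range p" using xy nbrs by auto
  qed
  show "X \<subseteq> p ` {..<r}"
  proof
    fix x assume "x \<in> X"
    with sub obtain i where "x = p (i mod r)" using p_mod by auto
    then show "x \<in> p ` {..<r}" using r by simp
  qed
qed auto

lemma r_ge: "r \<ge> 3"
proof (rule ccontr)
  assume "\<not> r \<ge> 3"
  \<comment> \<open>Period 1 would make the edge from \<open>p 0\<close> to \<open>p 1\<close> a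
    loop, and period 2 contradicts \<open>p_step2\<close>.\<close>
  then have "r = 1 \<or> r = 2" using r by auto
  then show False
    using r p_step2[of 0] p_edge[of 0] edges[of "p 0" "p 1"] by (auto simp: numeral_2_eq_2)
qed

definition f :: "'a \<Rightarrow> nat" where "f = inv_into {..<r} p"

lemma f_p: "f (p i) = i mod r"
  using inv_into_f_f[OF p_inj, of "i mod r"] r by (simp add: f_def p_mod)

lemma f_bij: "bij_betw f X {..<r}"
  unfolding f_def using bij_betw_inv_into[of p "{..<r}" X] p_inj p_surj
  by (simp add: bij_betw_def)

lemma inv_f: "i < r \<Longrightarrow> inv_into X f i = p i"
proof -
  assume "i < r"
  then have "f (p i) = i" by (simp add: f_p)
  then show ?thesis using inv_into_f_f[of f X "p i"] f_bij by (auto simp: bij_betw_def)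
qed

lemma f_edges: "cycle_edges r = (\<lambda>e. f ` e) ` E"
proof (intro equalityI subsetI)
  fix e assume "e \<in> cycle_edges r"
  then obtain i where "i < r" "e = {i, (i + 1) mod r}" by (auto simp: cycle_edges_def)
  then have "e = f ` {p i, p (Suc i)}" by (simp add: f_p)
  then show "e \<in> (\<lambda>e. f ` e) ` E" using p_edge by blast
next
  fix e assume "e \<in> (\<lambda>e. f ` e) ` E"
  then obtain x y where xy: "{x, y} \<in> E" "e = f ` {x, y}" using pairs by blast
  then obtain i where i: "i < r" "x = p i" using p_surj edges by blast
  then have "x = p (Suc (i + r - 1))" using r by simp
  then have "y = p (i + r - 1) \<or> y = p (Suc (Suc (i + r - 1)))" using xy nbrs by blast
  then have "y = p (i + r - 1) \<or> y = p (Suc (i + r))" using r by simp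
  then show "e \<in> cycle_edges r"
  proof
    assume y: "y = p (Suc (i + r))"
    have "f y = Suc i mod r" unfolding y f_p by (metis add_Suc mod_add_self2)
    then have "e = {i, (i + 1) mod r}" using xy i by (simp add: f_p)
    then show ?thesis using i by (auto simp: cycle_edges_def)
  next
    assume y: "y = p (i + r - 1)"
    \<comment> \<open>Here \<open>j\<close> is the predecessor of \<open>i\<close> modulo
      \<open>r\<close>; the edge is the one listed in \<open>cycle_edges\<close> under
      \<open>j\<close>.\<close>
    define j where "j = (i + r - 1) mod r"
    have "(j + 1) mod r = i"
      using i r unfolding j_def by (simp add: mod_simps)
    then have "e = {j, (j + 1) mod r}" using xy i y by (simp add: f_p j_def insert_commute)
    moreover have "j < r" using r by (simp add: j_def)
    ultimately show ?thesis by (auto simp: cycle_edges_def)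
  qed
qed

text \<open>The permutation \<open>g\<close> transported to the labels, as in
  \<open>pair_iso\<close>, with the walk \<open>p\<close> in place of the inverse of
  \<open>f\<close>.\<close>

definition shadow :: "('a \<Rightarrow> 'a) \<Rightarrow> nat \<Rightarrow> nat" where
  "shadow g = (\<lambda>i\<in>{..<r}. f (g (p i)))"

lemma shadow_eq: "(\<lambda>g. \<lambda>y\<in>{..<r}. f (g (inv_into X f y))) ` G = shadow ` G"
  unfolding shadow_def by (intro image_cong refl restrict_ext) (simp add: inv_f)

text \<open>The image of \<open>p 0\<close> is some \<open>p k\<close>, and \<open>p 1\<close> goes
  to one of its two neighbours. This choice decides everything: each further image is a neighbour of
  the last one and differs from the one before. In the second case \<open>i\<close> is bounded by
  \<open>r\<close> because \<open>r - i\<close> is truncated subtraction.\<close>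

lemma rotation_or_reflection:
  assumes g: "g \<in> G"
  obtains k where "k < r" "\<And>i. g (p i) = p (i + k)"
  | k where "k < r" "\<And>i. i \<le> r \<Longrightarrow> g (p i) = p (k + (r - i))"
proof -
  have "g (p 0) \<in> p ` {..<r}" using p_surj g by simp
  then obtain k where k: "k < r" "g (p 0) = p k" by auto
  then have k': "g (p 0) = p (Suc (k + (r - 1)))" using r by simp
  have "{g (p 0), g (p 1)} \<in> E" using aut[OF g p_edge[of 0]] by simp
  then have "g (p 1) = p (k + (r - 1)) \<or> g (p 1) = p (Suc (Suc (k + (r - 1))))"
    unfolding k' nbrs .
  moreover have "p (Suc (Suc (k + (r - 1)))) = p (Suc k)"
    using p_plus_r[of "Suc k"] r by simp
  ultimately consider "g (p 1) = p (Suc k)" | "g (p 1) = p (k + (r - 1))" by auto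
  then show thesis
  proof cases
    case 1
    have "g (p i) = p (i + k) \<and> g (p (Suc i)) = p (Suc (i + k))" for i
    proof (induction i)
      case 0
      then show ?case using 1 k by simp
    next
      case (Suc i)
      have "{g (p (Suc i)), g (p (Suc (Suc i)))} \<in> E" by (rule aut[OF g p_edge])
      then have "g (p (Suc (Suc i))) = p (i + k) \<or> g (p (Suc (Suc i))) = p (Suc (Suc (i + k)))"
        using Suc nbrs by simp
      moreover have "g (p (Suc (Suc i))) \<noteq> g (p i)" using g p_step2 by simp
      ultimately show ?case using Suc by auto
    qed
    then show thesis using that(1) k by blast
  next
    case 2
    have "Suc i \<le> r \<Longrightarrow> g (p i) = p (k + (r - i)) \<and> g (p (Suc i)) = p (k + (r - Suc i))" for i
    proof (induction i)
      case 0
      then show ?case using 2 k by simp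
    next
      case (Suc i)
      \<comment> \<open>The smallest index in play; in terms of \<open>m\<close> the truncated
        differences become successors, as \<open>nbrs\<close> needs.\<close>
      define m where "m = k + (r - Suc (Suc i))"
      have m: "k + (r - Suc i) = Suc m" "k + (r - i) = Suc (Suc m)"
        using Suc.prems by (auto simp: m_def)
      have IH: "g (p i) = p (Suc (Suc m))" "g (p (Suc i)) = p (Suc m)"
        using Suc m by auto
      have "{g (p (Suc i)), g (p (Suc (Suc i)))} \<in> E" by (rule aut[OF g p_edge])
      then have "g (p (Suc (Suc i))) = p m \<or> g (p (Suc (Suc i))) = p (Suc (Suc m))"
        using IH nbrs by simp
      moreover have "g (p (Suc (Suc i))) \<noteq> g (p i)" using g p_step2 by simp
      ultimately show ?case using IH m by (auto simp: m_def)
    qed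
    then have "g (p i) = p (k + (r - i))" if "i \<le> r" for i
      using that r by (cases i) auto
    then show thesis using that(2) k by blast
  qed
qed

lemma rotation_in:
  obtains g where "g \<in> G" "\<And>i. g (p i) = p (i + k)"
proof -
  obtain g where g: "g \<in> G" "\<And>x. x \<in> X \<Longrightarrow> g x = (h ^^ k) x" using funpow_in[OF h] by blast
  then have "g (p i) = p (i + k)" for i using p_add[of k i] by (simp add: add.commute)
  then show thesis using that g by blast
qed

lemma rotations_subset: "rotations r \<subseteq> shadow ` G"
proof
  fix s assume "s \<in> rotations r"
  then obtain k where k: "s = (\<lambda>i\<in>{..<r}. (i + k) mod r)" by (auto simp: rotations_def)
  obtain g where "g \<in> G" "\<And>i. g (p i) = p (i + k)" using rotation_in by blast
  then have "g \<in> G" "s = shadow g" by (auto simp: k shadow_def f_p)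
  then show "s \<in> shadow ` G" by blast
qed

text \<open>All rotations occur, by \<open>rotations_subset\<close>. One reflection composed with
  them yields every reflection; without a reflection only the rotations remain.\<close>

lemma shadow_group: "shadow ` G = dihedral r \<or> shadow ` G = rotations r"
proof (cases "\<exists>g\<in>G. \<exists>k<r. \<forall>i\<le>r. g (p i) = p (k + (r - i))")
  case True
  then obtain g k where g: "g \<in> G" "k < r" "\<And>i. i \<le> r \<Longrightarrow> g (p i) = p (k + (r - i))" by blast
  have "shadow ` G \<subseteq> dihedral r"
  proof
    fix s assume "s \<in> shadow ` G"
    then obtain g where g: "g \<in> G" "s = shadow g" by blast
    then show "s \<in> dihedral r"
    proof (cases rule: rotation_or_reflection[OF g(1)])
      case (1 k)
      then have "s = (\<lambda>i\<in>{..<r}. (i + k) mod r)"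
        unfolding g(2) shadow_def by (intro restrict_ext) (simp add: f_p)
      then show ?thesis using 1 by (auto simp: dihedral_def rotations_def)
    next
      case (2 k)
      then have "s = (\<lambda>i\<in>{..<r}. (k + (r - i)) mod r)"
        unfolding g(2) shadow_def by (intro restrict_ext) (simp add: f_p)
      then show ?thesis using 2 by (auto simp: dihedral_def)
    qed
  qed
  moreover have "dihedral r \<subseteq> shadow ` G"
  proof
    fix s assume "s \<in> dihedral r"
    then consider "s \<in> rotations r" | l where "l < r" "s = (\<lambda>i\<in>{..<r}. (l + (r - i)) mod r)"
      by (auto simp: dihedral_def)
    then show "s \<in> shadow ` G"
    proof cases
      case 1
      then show ?thesis using rotations_subset by blast
    next
      case 2
      \<comment> \<open>The rotation by \<open>l - k\<close>, with \<open>r\<close> added to stay in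
        the natural numbers, changes the offset of the reflection from \<open>k\<close> to
        \<open>l\<close>.\<close>
      obtain a where a: "a \<in> G" "\<And>i. a (p i) = p (i + (l + r - k))" using rotation_in by blast
      have "shadow (compose X a g) = s"
        unfolding shadow_def 2(2)
      proof (rule restrict_ext)
        fix i assume "i \<in> {..<r}"
        then have i: "i < r" by simp
        then have "compose X a g (p i) = p (k + (r - i) + (l + r - k))"
          using g(3)[of i] a by (simp add: compose_def)
        also have "k + (r - i) + (l + r - k) = (l + (r - i)) + r" using g(2) i by simp
        finally show "f (compose X a g (p i)) = (l + (r - i)) mod r" by (simp add: f_p)
      qed
      then show ?thesis using compose_in[OF a(1) g(1)] by blast
    qed
  qed
  ultimately show ?thesis by blast
next
  case False
  have "shadow ` G \<subseteq> rotations r"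
  proof
    fix s assume "s \<in> shadow ` G"
    then obtain g where g: "g \<in> G" "s = shadow g" by blast
    then obtain k where "k < r" "\<And>i. g (p i) = p (i + k)"
      using rotation_or_reflection[OF g(1)] False by metis
    then show "s \<in> rotations r" using g by (auto simp: shadow_def f_p rotations_def)
  qed
  then show ?thesis using rotations_subset by blast
qed

lemma pair_iso_cycle:
  "\<exists>r\<ge>3. pair_iso X E G {..<r} (cycle_edges r) (dihedral r) \<or>
          pair_iso X E G {..<r} (cycle_edges r) (rotations r)"
  using r_ge shadow_group f_bij f_edges shadow_eq unfolding pair_iso_def by metis

end

section \<open>Normal quotients of oriented graphs\<close>

text \<open>Fixes one orientation \<open>D\<close> out of those that \<open>oriented_graph\<close>
  asserts to exist, so that arcs can be named; \<open>OG4_imp_og4\<close> supplies it.\<close>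

locale og4 = perm_grp +
  fixes E :: "'a set set" and D :: "('a \<times> 'a) set"
  assumes OG4: "OG4 X E G"
    and D_orbit: "D \<in> orbits (perm_group X G) (X \<times> X) (\<lambda>g. map_prod g g)"
    and D_asym: "D \<inter> D\<inverse> = {}"
    and E_eq: "E = {{x, y} | x y. (x, y) \<in> D \<or> (y, x) \<in> D}"
begin

lemma finX: "finite X" and conn: "connected_graph X E" and val4: "regular_graph X E 4"
  using OG4 unfolding OG4_def finite_simple_graph_def by blast+

lemma vertex_trans: "x \<in> X \<Longrightarrow> y \<in> X \<Longrightarrow> \<exists>g\<in>G. g x = y"
  using OG4 unfolding OG4_def by blast

lemma base_arc:
  obtains a b where "a \<in> X" "b \<in> X" "\<And>x y. (x, y) \<in> D \<longleftrightarrow> (\<exists>g\<in>G. x = g a \<and> y = g b)"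
proof -
  obtain a b where "a \<in> X" "b \<in> X" "D = orbit (perm_group X G) (\<lambda>g. map_prod g g) (a, b)"
    using D_orbit unfolding orbits_def by blast
  then show thesis by (intro that[of a b]) (auto simp: orbit_def)
qed

lemma D_in: "(x, y) \<in> D \<Longrightarrow> x \<in> X \<and> y \<in> X"
  by (rule base_arc) auto

lemma edge_iff: "{x, y} \<in> E \<longleftrightarrow> (x, y) \<in> D \<or> (y, x) \<in> D"
  unfolding E_eq by (auto simp: doubleton_eq_iff)

lemma edge_in: "{x, y} \<in> E \<Longrightarrow> x \<in> X \<and> y \<in> X"
  using D_in by (auto simp: edge_iff)

lemma D_antisym: "(x, y) \<in> D \<Longrightarrow> (y, x) \<notin> D"
  using D_asym by auto

lemma edge_pair: "e \<in> E \<Longrightarrow> \<exists>x y. e = {x, y}"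
  unfolding E_eq by auto

lemma arc_closed: "g \<in> G \<Longrightarrow> (x, y) \<in> D \<Longrightarrow> (g x, g y) \<in> D"
proof -
  assume g: "g \<in> G" and xy: "(x, y) \<in> D"
  obtain a b where ab: "a \<in> X" "b \<in> X" "\<And>x y. (x, y) \<in> D \<longleftrightarrow> (\<exists>g\<in>G. x = g a \<and> y = g b)"
    by (rule base_arc) (rule that)
  obtain h where h: "h \<in> G" "x = h a" "y = h b" using xy unfolding ab(3) by (elim bexE conjE)
  then have "compose X g h \<in> G" "g x = compose X g h a" "g y = compose X g h b"
    using ab(1,2) h compose_in[OF g h(1)] by (simp_all add: compose_def)
  then show ?thesis unfolding ab(3) by (intro bexI conjI)
qed

lemma edge_closed: "g \<in> G \<Longrightarrow> {x, y} \<in> E \<Longrightarrow> {g x, g y} \<in> E"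
  unfolding edge_iff using arc_closed[of g x y] arc_closed[of g y x] by blast

lemma edge_closed_iff: "g \<in> G \<Longrightarrow> x \<in> X \<Longrightarrow> y \<in> X \<Longrightarrow> {g x, g y} \<in> E \<longleftrightarrow> {x, y} \<in> E"
  using OG4 unfolding OG4_def graph_aut_def by blast

text \<open>Both arcs are images of the base arc, under \<open>h\<close> and \<open>k\<close>, so
  \<open>k\<close> after the inverse of \<open>h\<close> works. Unlike edge transitivity, this
  prescribes which end goes where.\<close>

lemma arc_trans:
  assumes "(x, y) \<in> D" "(x', y') \<in> D"
  obtains g where "g \<in> G" "g x = x'" "g y = y'"
proof -
  obtain a b where ab: "a \<in> X" "b \<in> X" "\<And>x y. (x, y) \<in> D \<longleftrightarrow> (\<exists>g\<in>G. x = g a \<and> y = g b)"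
    by (rule base_arc) (rule that)
  obtain h where h: "h \<in> G" "x = h a" "y = h b"
    using assms(1) unfolding ab(3) by (elim bexE conjE)
  obtain k where k: "k \<in> G" "x' = k a" "y' = k b"
    using assms(2) unfolding ab(3) by (elim bexE conjE)
  obtain h' where h': "h' \<in> G" "\<And>x. x \<in> X \<Longrightarrow> h' (h x) = x"
    by (rule ex_inv[OF h(1)]) (rule that)
  have "compose X k h' (h c) = k c" if "c \<in> X" for c
    using that h(1) h'(2) by (simp add: compose_def)
  then have "compose X k h' x = x'" "compose X k h' y = y'"
    unfolding h k using ab(1,2) by blast+
  then show thesis by (rule that[OF compose_in[OF k(1) h'(1)]])
qed

lemma ex_arc: "\<exists>a b. (a, b) \<in> D"
proof (rule base_arc)
  fix a b assume "\<And>x y. (x, y) \<in> D \<longleftrightarrow> (\<exists>g\<in>G. x = g a \<and> y = g b)"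
  then have "((\<lambda>x\<in>X. x) a, (\<lambda>x\<in>X. x) b) \<in> D" using id_in by blast
  then show ?thesis by blast
qed

lemma ex_out: "x \<in> X \<Longrightarrow> \<exists>y. (x, y) \<in> D"
proof -
  assume x: "x \<in> X"
  obtain a b where ab: "(a, b) \<in> D" using ex_arc by blast
  then obtain g where "g \<in> G" "g a = x" using vertex_trans[OF _ x] D_in by blast
  then show ?thesis using arc_closed[OF _ ab] by auto
qed

end

lemma OG4_imp_og4:
  assumes "OG4 X E G"
  obtains D where "og4 X G E D"
proof -
  have sub: "subgroup G (BijGroup X)" and "oriented_graph X E G"
    using assms by (simp_all add: OG4_def)
  then obtain D where "D \<in> orbits (perm_group X G) (X \<times> X) (\<lambda>g. map_prod g g)"
    "D \<inter> D\<inverse> = {}" "E = {{x, y} | x y. (x, y) \<in> D \<or> (y, x) \<in> D}"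
    unfolding oriented_graph_def by (elim bexE conjE)
  then have "og4 X G E D" by (intro og4.intro perm_grp.intro og4_axioms.intro sub assms)
  then show thesis by (rule that)
qed

text \<open>The dividing line between degenerate quotients and covers. Edges inside an orbit are
  excluded as a consequence, in \<open>locally_injective_noloop\<close>.\<close>

definition locally_injective :: "'a set set \<Rightarrow> ('a \<Rightarrow> 'a) set \<Rightarrow> bool" where
  "locally_injective E N \<longleftrightarrow>
     (\<forall>x y z. {x, y} \<in> E \<longrightarrow> {x, z} \<in> E \<longrightarrow> orb N y = orb N z \<longrightarrow> y = z)"

locale og4_normal = og4 + normal_perm
begin

abbreviation V where "V \<equiv> quot_verts X N"
abbreviation F where "F \<equiv> quot_edges X E N"

lemma finV: "finite V"
  using finX by (simp add: quot_verts_eq)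

lemma finite_vert: "C \<in> V \<Longrightarrow> finite C"
  by (erule vertE) (simp add: finite_subset[OF orb_subset finX])

lemma vert_eq: "C \<in> V \<Longrightarrow> y \<in> C \<Longrightarrow> y \<in> X \<and> C = orb N y"
  by (erule vertE) (metis orb_eq orb_in)

text \<open>An element of \<open>N\<close> taking \<open>x'\<close> to \<open>x\<close> carries the
  edge along and leaves the orbit of its other end unchanged.\<close>

lemma shift_edge:
  assumes "{x', y'} \<in> E" "orb N x' = orb N x" "x \<in> X"
  obtains y where "{x, y} \<in> E" "orb N y = orb N y'"
proof -
  have in_X: "x' \<in> X" "y' \<in> X" using edge_in[OF assms(1)] by auto
  obtain n where n: "n \<in> N" "x = n x'"
    using orb_eqD[OF in_X(1) assms(3) assms(2)[symmetric]] by (elim bexE)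
  have "{x, n y'} \<in> E" using edge_closed[OF N_in_G[OF n(1)] assms(1)] unfolding n(2) .
  then show thesis using that orb_n[OF n(1) in_X(2)] by blast
qed

text \<open>By \<open>shift_edge\<close> the edge witnessing adjacency of two orbits can be moved to
  any chosen representative \<open>x\<close>.\<close>

lemma qedge_iff:
  assumes x: "x \<in> X"
  shows "{orb N x, C} \<in> F \<longleftrightarrow> C \<noteq> orb N x \<and> (\<exists>y. {x, y} \<in> E \<and> C = orb N y)"
proof
  assume "{orb N x, C} \<in> F"
  then obtain B' C' u w where BC: "{orb N x, C} = {B', C'}" "B' \<in> V" "C' \<in> V" "B' \<noteq> C'"
    "u \<in> B'" "w \<in> C'" "{u, w} \<in> E" unfolding quot_edges_def by blast
  from BC(1) consider "B' = orb N x" "C' = C" | "B' = C" "C' = orb N x"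
    unfolding doubleton_eq_iff by blast
  then obtain x' y' where xy: "C \<noteq> orb N x" "C \<in> V" "x' \<in> orb N x" "y' \<in> C" "{x', y'} \<in> E"
  proof cases
    case 1
    then show thesis using that[of u w] BC by simp
  next
    case 2
    then show thesis using that[of w u] BC by (simp add: insert_commute)
  qed
  obtain y where "{x, y} \<in> E" "orb N y = orb N y'"
    using shift_edge[OF xy(5) orb_eq[OF xy(3) x] x] by blast
  moreover have "C = orb N y'" using vert_eq[OF xy(2,4)] by blast
  ultimately show "C \<noteq> orb N x \<and> (\<exists>y. {x, y} \<in> E \<and> C = orb N y)" using xy(1) by auto
next
  assume "C \<noteq> orb N x \<and> (\<exists>y. {x, y} \<in> E \<and> C = orb N y)"
  then obtain y where y: "C \<noteq> orb N x" "{x, y} \<in> E" "C = orb N y" by blast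
  then have yX: "y \<in> X" using edge_in by blast
  then have "\<exists>u\<in>orb N x. \<exists>w\<in>orb N y. {u, w} \<in> E"
    using y(2) orb_self[OF x] orb_self[OF yX] by blast
  then show "{orb N x, C} \<in> F"
    unfolding quot_edges_def mem_Collect_eq using y orb_vert[OF x] orb_vert[OF yX]
    by (intro exI[of _ "orb N x"] exI[of _ C]) simp
qed

lemma qedge_orbE:
  assumes "{B, C} \<in> F"
  obtains x y where "x \<in> X" "y \<in> X" "B = orb N x" "C = orb N y" "{x, y} \<in> E" "B \<noteq> C"
proof -
  have "\<exists>B'\<in>V. \<exists>C'\<in>V. {B, C} = {B', C'}" using assms unfolding quot_edges_def by blast
  then have "B \<in> V" unfolding doubleton_eq_iff by (elim bexE) (metis)
  then obtain x where x: "x \<in> X" "B = orb N x" by (rule vertE)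
  obtain y where y: "C \<noteq> orb N x" "{x, y} \<in> E" "C = orb N y"
    using assms unfolding x(2) qedge_iff[OF x(1)] by (elim conjE exE)
  have "y \<in> X" using edge_in[OF y(2)] by blast
  moreover have "B \<noteq> C" using x(2) y(1) by metis
  ultimately show thesis using that[OF x(1) _ x(2) y(3) y(2)] by blast
qed

lemma F_pair: "e \<in> F \<Longrightarrow> \<exists>B C. e = {B, C}"
  by (auto simp: quot_edges_def)

lemma F_in: "{B, C} \<in> F \<Longrightarrow> B \<in> V \<and> C \<in> V \<and> B \<noteq> C"
  by (elim qedge_orbE) simp

lemma simple_quot: "finite_simple_graph V F"
  unfolding finite_simple_graph_def using finV by (auto simp: quot_edges_def)

text \<open>A walk in the graph projects to the quotient; an edge inside an orbit contributes no
  step.\<close>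

lemma conn_quot: "connected_graph V F"
  unfolding connected_graph_def
proof (intro conjI ballI)
  show "V \<noteq> {}" using conn by (simp add: quot_verts_eq connected_graph_def)
  fix B C assume "B \<in> V" "C \<in> V"
  then obtain x y where x: "x \<in> X" "B = orb N x" and y: "y \<in> X" "C = orb N y"
    by (meson vertE)
  have "(x, y) \<in> {(u, v). {u, v} \<in> E}\<^sup>*" using conn x y by (simp add: connected_graph_def)
  then have "(orb N x, orb N y) \<in> {(u, v). {u, v} \<in> F}\<^sup>*"
  proof induction
    case (step y z)
    then have yz: "{y, z} \<in> E" "y \<in> X" using edge_in by auto
    show ?case
    proof (cases "orb N y = orb N z")
      case False
      then have "{orb N y, orb N z} \<in> F" using yz qedge_iff by metis
      then show ?thesis using step.IH by (simp add: rtrancl.rtrancl_into_rtrancl)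
    qed (use step in simp)
  qed simp
  then show "(B, C) \<in> {(u, v). {u, v} \<in> F}\<^sup>*" using x y by simp
qed

lemma qact_edge: "g \<in> G \<Longrightarrow> {B, C} \<in> F \<Longrightarrow> {qact g B, qact g C} \<in> F"
proof (elim qedge_orbE)
  fix x y assume g: "g \<in> G" and xy: "x \<in> X" "y \<in> X" "B = orb N x" "C = orb N y" "{x, y} \<in> E" "B \<noteq> C"
  have ne: "qact g B \<noteq> qact g C"
    using Q.eq_iff[of "qact g" B C] g xy by (simp add: quot_group_eq)
  have "{g x, g y} \<in> E" using edge_closed g xy by simp
  then have "{orb N (g x), orb N (g y)} \<in> F" using g xy ne by (auto simp: qedge_iff)
  then show ?thesis using g xy by simp
qed

lemma quot_edge_closed: "h \<in> quot_group X G N \<Longrightarrow> {B, C} \<in> F \<Longrightarrow> {h B, h C} \<in> F"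
  using qact_edge by (auto simp: quot_group_eq)

lemma quot_vertex_trans: "B \<in> V \<Longrightarrow> C \<in> V \<Longrightarrow> \<exists>h\<in>quot_group X G N. h B = C"
proof (elim vertE)
  fix x y assume xy: "x \<in> X" "y \<in> X" "B = orb N x" "C = orb N y"
  then obtain g where "g \<in> G" "g x = y" using vertex_trans by blast
  then show ?thesis using xy by (auto simp: quot_group_eq)
qed

text \<open>Since \<open>G\<close> is transitive on arcs and permutes the orbits, one edge inside an
  orbit puts every edge inside an orbit; connectedness then leaves a single orbit.\<close>

lemma loop_imp_single:
  assumes "{x, y} \<in> E" "orb N x = orb N y"
  shows "V = {orb N x}"
proof -
  have x: "x \<in> X" "y \<in> X" using assms edge_in by auto
  have loops: "orb N a = orb N b" if uv: "(u, v) \<in> D" "orb N u = orb N v" and ab: "(a, b) \<in> D" for u v a b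
  proof -
    obtain g where "g \<in> G" "g u = a" "g v = b" using arc_trans[OF uv(1) ab] by blast
    moreover have "u \<in> X" "v \<in> X" using D_in[OF uv(1)] by auto
    ultimately show ?thesis
      using image_orb[of g u] image_orb[of g v] uv(2) by simp
  qed
  have "\<exists>u v. (u, v) \<in> D \<and> orb N u = orb N v" using assms edge_iff by metis
  then have "orb N a = orb N b" if "{a, b} \<in> E" for a b
    using loops that edge_iff by metis
  then have "X \<subseteq> {a. orb N a = orb N x}"
    by (intro connected_closed[OF conn x(1)]) auto
  then show ?thesis using x by (auto simp: quot_verts_eq)
qed

lemma degenerate_single:
  assumes "V = {B}"
  shows "degenerate_quotient X E G N"
proof -
  have F: "F = {}" unfolding quot_edges_def assms by auto
  let ?f = "\<lambda>_::'a set. 0::nat"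
  have "bij_betw ?f V {..<1}" by (auto simp: assms bij_betw_def)
  moreover have "complete_edges 1 = (\<lambda>e. ?f ` e) ` F" by (auto simp: F complete_edges_def)
  moreover have "rotations 1 = (\<lambda>g. \<lambda>y\<in>{..<1}. ?f (g (inv_into V ?f y))) ` quot_group X G N"
  proof -
    \<comment> \<open>The constant labelling turns every group element into this one map, so it only
      matters that the induced group is nonempty.\<close>
    have "rotations 1 = {\<lambda>y\<in>{..<1}. 0}" by (auto simp: rotations_def intro!: restrict_ext)
    then show ?thesis using Q.id_in by auto
  qed
  ultimately have "pair_iso V F (quot_group X G N) {..<1} (complete_edges 1) (rotations 1)"
    unfolding pair_iso_def by blast
  then show ?thesis by (simp add: degenerate_quotient_def Let_def)
qed

section \<open>Counting edges between orbits\<close>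

lemma card_nbrs_translate:
  assumes "g \<in> G" "x \<in> X" "C \<in> V"
  shows "card {y \<in> g ` C. {g x, y} \<in> E} = card {y \<in> C. {x, y} \<in> E}"
proof -
  have C: "C \<subseteq> X" using assms vert_eq by blast
  have "{y \<in> g ` C. {g x, y} \<in> E} = g ` {y \<in> C. {x, y} \<in> E}"
    using edge_closed_iff[OF assms(1,2)] C by blast
  moreover have "inj_on g {y \<in> C. {x, y} \<in> E}"
    using C by (intro inj_on_subset[OF inj[OF assms(1)]]) auto
  ultimately show ?thesis by (simp add: card_image)
qed

lemma card_nbrs_orb:
  assumes "x' \<in> orb N x" "x \<in> X" "C \<in> V"
  shows "card {y \<in> C. {x', y} \<in> E} = card {y \<in> C. {x, y} \<in> E}"
proof -
  obtain n where n: "n \<in> N" "x' = n x" using assms(1) by (auto simp: orb_def)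
  obtain c where "c \<in> X" "C = orb N c" using assms(3) by (rule vertE)
  then have "n ` C = C" using image_orb[of n c] n by simp
  then show ?thesis using card_nbrs_translate[of n x C] n assms by simp
qed

text \<open>Count the edges between the two orbits from both sides. By \<open>card_nbrs_orb\<close>
  each vertex of one side contributes equally, and the orbits have the same size.\<close>

lemma card_nbrs_sym:
  assumes "x \<in> X" "y \<in> X"
  shows "card {z \<in> orb N y. {x, z} \<in> E} = card {z \<in> orb N x. {y, z} \<in> E}"
proof -
  let ?B = "orb N x" and ?C = "orb N y"
  have fin: "finite ?B" "finite ?C" using finite_vert assms by simp_all
  have BV: "?B \<in> V" "?C \<in> V" using assms by simp_all
  have "card {z \<in> ?B. {z, w} \<in> E} = card {z \<in> ?B. {y, z} \<in> E}" if "w \<in> ?C" for w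
    using card_nbrs_orb[OF that assms(2) BV(1)] by (simp only: insert_commute[of _ w])
  then have "(\<Sum>z\<in>?B. card {w \<in> ?C. {z, w} \<in> E}) = card {z \<in> ?B. {y, z} \<in> E} * card ?C"
    by (intro sum_multicount[OF fin] ballI)
  moreover have "(\<Sum>z\<in>?B. card {w \<in> ?C. {z, w} \<in> E}) = (\<Sum>z\<in>?B. card {w \<in> ?C. {x, w} \<in> E})"
    by (intro sum.cong refl card_nbrs_orb assms(1) BV)
  moreover have "card ?B = card ?C" using card_vert assms vertex_trans by simp
  moreover have "card ?B > 0" using fin orb_self[OF assms(1)] by (auto simp: card_gt_0_iff)
  ultimately show ?thesis by simp
qed

text \<open>Arc transitivity makes the count from the tail of an arc into the orbit of its head
  constant; \<open>card_nbrs_sym\<close> gives the same number against the direction of the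
  arc.\<close>

lemma ex_multicover: "\<exists>l. normal_multicover l X E N"
proof -
  obtain a b where ab: "(a, b) \<in> D" using ex_arc by blast
  let ?l = "card {y \<in> orb N b. {a, y} \<in> E}"
  have arc: "card {z \<in> orb N y. {x, z} \<in> E} = ?l" if xy: "(x, y) \<in> D" for x y
  proof -
    obtain g where g: "g \<in> G" "g a = x" "g b = y" using arc_trans[OF ab xy] by blast
    then show ?thesis
      using card_nbrs_translate[of g a "orb N b"] D_in[OF ab] by (simp add: image_orb)
  qed
  have "normal_multicover ?l X E N"
    unfolding normal_multicover_def
  proof (intro allI impI ballI)
    fix B C x' assume BC: "{B, C} \<in> F" and x': "x' \<in> B"
    obtain x y where xy: "x \<in> X" "y \<in> X" "B = orb N x" "C = orb N y" "{x, y} \<in> E"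
      using BC by (rule qedge_orbE)
    have xl: "card {y \<in> C. {x, y} \<in> E} = ?l"
      using xy(5) arc[of x y] arc[of y x] card_nbrs_sym[OF xy(1,2)]
      unfolding xy(4) edge_iff[of x y] by argo
    have "C \<in> V" using xy by simp
    with x' xy have "card {y \<in> C. {x', y} \<in> E} = card {y \<in> C. {x, y} \<in> E}"
      by (intro card_nbrs_orb) simp_all
    then show "card {y \<in> C. {x', y} \<in> E} = ?l" using xl by simp
  qed
  then show ?thesis by blast
qed

text \<open>The four neighbours of \<open>x\<close> are sorted by their orbits. All these orbits are
  adjacent to that of \<open>x\<close>, as no edge stays inside an orbit, and each receives
  \<open>l\<close> of the neighbours.\<close>

lemma multicover_valency:
  assumes noloop: "\<And>x y. {x, y} \<in> E \<Longrightarrow> orb N x \<noteq> orb N y"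
    and l: "normal_multicover l X E N"
  shows "\<exists>k. l * k = 4 \<and> regular_graph V F k"
proof -
  have "l * card {C \<in> V. {B, C} \<in> F} = 4" if B: "B \<in> V" for B
  proof -
    obtain x where x: "x \<in> X" "B = orb N x" using B by (rule vertE)
    let ?A = "{y \<in> X. {x, y} \<in> E}"
    have A: "orb N ` ?A = {C \<in> V. {B, C} \<in> F}"
    proof (intro equalityI subsetI)
      fix C assume "C \<in> orb N ` ?A"
      then obtain y where y: "y \<in> X" "{x, y} \<in> E" "C = orb N y" by (elim imageE CollectE conjE)
      have "C \<noteq> orb N x" using noloop[OF y(2)] unfolding y(3) by metis
      then have "{B, C} \<in> F" unfolding x(2) qedge_iff[OF x(1)] using y(2,3) by blast
      then show "C \<in> {C \<in> V. {B, C} \<in> F}" using F_in by blast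
    next
      fix C assume "C \<in> {C \<in> V. {B, C} \<in> F}"
      then obtain y where y: "{x, y} \<in> E" "C = orb N y"
        unfolding x(2) mem_Collect_eq qedge_iff[OF x(1)] by (elim conjE exE)
      then show "C \<in> orb N ` ?A" using edge_in[OF y(1)] by blast
    qed
    have "4 = card ?A" using val4 x by (simp add: regular_graph_def)
    also have "\<dots> = (\<Sum>y\<in>?A. 1)" by simp
    also have "\<dots> = (\<Sum>C\<in>orb N ` ?A. \<Sum>y\<in>{y \<in> ?A. orb N y = C}. 1)"
      using finX by (intro sum.image_gen) auto
    also have "\<dots> = (\<Sum>C\<in>orb N ` ?A. l)"
    proof (rule sum.cong[OF refl])
      fix C assume C: "C \<in> orb N ` ?A"
      then have C': "C \<in> V" "{B, C} \<in> F" unfolding A by auto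
      have "{y \<in> ?A. orb N y = C} = {y \<in> C. {x, y} \<in> E}"
      proof -
        have "y \<in> X \<and> orb N y = C \<longleftrightarrow> y \<in> C" for y
          using vert_eq[OF C'(1)] orb_self by metis
        then show ?thesis by blast
      qed
      moreover have "card {y \<in> C. {x, y} \<in> E} = l"
        using l C'(2) orb_self[OF x(1)] unfolding normal_multicover_def x(2) by blast
      ultimately show "(\<Sum>y\<in>{y \<in> ?A. orb N y = C}. 1) = l" by simp
    qed
    also have "\<dots> = l * card {C \<in> V. {B, C} \<in> F}" unfolding A by simp
    finally show ?thesis by simp
  qed
  note count = this
  obtain B where "B \<in> V" using conn_quot unfolding connected_graph_def by blast
  then have lB: "l * card {C \<in> V. {B, C} \<in> F} = 4" by (rule count)
  then have l0: "l \<noteq> 0" by (cases "l = 0") simp_all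
  \<comment> \<open>Dividing by \<open>l\<close>, which is nonzero because the product is 4, gives
    the same valency at every orbit.\<close>
  have d: "card {C \<in> V. {B, C} \<in> F} = 4 div l" if "B \<in> V" for B
    unfolding count[OF that, symmetric] using l0 by simp
  then have "l * (4 div l) = 4" using lB \<open>B \<in> V\<close> by simp
  with d show ?thesis
    unfolding regular_graph_def by (intro exI[of _ "4 div l"]) simp
qed

end

section \<open>Degenerate quotients\<close>

context og4_normal
begin

text \<open>Valency 1 and connectedness leave just two orbits. Vertex transitivity provides both the
  identity and the swap, and the absence of edges inside orbits makes the orbits a
  bipartition.\<close>

lemma degenerate_K2:
  assumes noloop: "\<And>x y. {x, y} \<in> E \<Longrightarrow> orb N x \<noteq> orb N y"
    and one: "regular_graph V F 1"
  shows "degenerate_quotient X E G N"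
proof -
  let ?H = "quot_group X G N"
  obtain a b where ab: "(a, b) \<in> D" using ex_arc by blast
  then have abX: "a \<in> X" "b \<in> X" and abE: "{a, b} \<in> E" using D_in edge_iff by auto
  define B where "B = orb N a"
  define C where "C = orb N b"
  have BC: "B \<noteq> C" "B \<in> V" "C \<in> V" using noloop[OF abE] abX by (simp_all add: B_def C_def)
  have F: "{B, C} \<in> F"
    using BC(1) abE unfolding B_def C_def qedge_iff[OF abX(1)] by blast
  have uniq: "S = S'" if "R \<in> V" "{R, S} \<in> F" "{R, S'} \<in> F" for R S S'
  proof -
    have "card {S \<in> V. {R, S} \<in> F} = 1" using one that(1) by (simp add: regular_graph_def)
    then obtain T where T: "{S \<in> V. {R, S} \<in> F} = {T}" by (rule card_1_singletonE)
    have "S \<in> {S \<in> V. {R, S} \<in> F}" "S' \<in> {S \<in> V. {R, S} \<in> F}" using that F_in by blast+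
    then show ?thesis unfolding T by simp
  qed
  have "V \<subseteq> {B, C}"
  proof (rule connected_closed[OF conn_quot BC(2)])
    fix R S assume "R \<in> {B, C}" "{R, S} \<in> F"
    moreover have "{C, B} \<in> F" using F by (simp add: insert_commute)
    ultimately show "S \<in> {B, C}" using uniq F BC by blast
  qed simp
  then have V: "V = {B, C}" using BC by blast
  have F_eq: "F = {{B, C}}"
  proof (intro equalityI subsetI)
    fix e assume e: "e \<in> F"
    then obtain R S where RS: "e = {R, S}" using F_pair by blast
    then have "R \<in> {B, C}" "S \<in> {B, C}" "R \<noteq> S" using F_in[of R S] e V by simp_all
    then show "e \<in> {{B, C}}" unfolding RS by (auto simp: insert_commute)
  qed (use F in simp)
  define f where "f S = (if S = B then 0 else 1::nat)" for S
  have two: "{..<2::nat} = {0, 1}" by auto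
  have fBC: "f B = 0" "f C = 1" using BC by (auto simp: f_def)
  have f_inj: "inj_on f V" unfolding V using fBC by auto
  have f_bij: "bij_betw f V {..<2}"
    using f_inj fBC by (simp add: bij_betw_def V two)
  have inv: "inv_into V f 0 = B" "inv_into V f 1 = C"
    using inv_into_f_f[OF f_inj BC(2)] inv_into_f_f[OF f_inj BC(3)] fBC by simp_all
  have edges: "complete_edges 2 = (\<lambda>e. f ` e) ` F"
  proof -
    have "complete_edges 2 = {{0, 1}}"
      unfolding complete_edges_def by (auto simp: less_2_cases_iff doubleton_eq_iff)
    then show ?thesis by (simp add: F_eq fBC)
  qed
  \<comment> \<open>The permutation \<open>h\<close> transported to the labels 0 and 1, in the form
    demanded by \<open>pair_iso\<close>.\<close>
  define s where "s h = (\<lambda>y\<in>{..<2}. f (h (inv_into V f y)))" for h :: "'a set \<Rightarrow> 'a set"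
  define i2 where "i2 = (\<lambda>i\<in>{..<2::nat}. i)"
  define sw where "sw = (\<lambda>i\<in>{..<2::nat}. 1 - i)"
  have rot: "rotations 2 = {i2, sw}"
  proof -
    have "rotations 2 = (\<lambda>k. \<lambda>i\<in>{..<2}. (i + k) mod 2) ` {0, 1}"
      unfolding rotations_def two[symmetric] by blast
    moreover have "(\<lambda>i\<in>{..<2}. (i + 0) mod 2) = i2" "(\<lambda>i\<in>{..<2::nat}. (i + 1) mod 2) = sw"
      unfolding i2_def sw_def by (auto intro!: restrict_ext simp: less_2_cases_iff)
    ultimately show ?thesis by simp
  qed
  have s: "(h B = B \<and> s h = i2) \<or> (h B = C \<and> s h = sw)" if h: "h \<in> ?H" for h
  proof -
    have "h B \<in> {B, C}" "h C \<in> {B, C}" "h B \<noteq> h C"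
      using Q.closed[OF h BC(2)] Q.closed[OF h BC(3)] Q.eq_iff[OF h BC(2,3)] BC(1) V by simp_all
    then consider "h B = B" "h C = C" | "h B = C" "h C = B" by auto
    then show ?thesis
    proof cases
      case 1
      have "f (h B) = 0" "f (h C) = 1" using 1 fBC by simp_all
      then have "s h = i2" unfolding s_def i2_def
        by (intro restrict_ext) (auto simp: less_2_cases_iff inv(1) inv(2)[unfolded One_nat_def])
      then show ?thesis using 1 by simp
    next
      case 2
      have "f (h B) = 1" "f (h C) = 0" using 2 fBC by simp_all
      then have "s h = sw" unfolding s_def sw_def
        by (intro restrict_ext) (auto simp: less_2_cases_iff inv(1) inv(2)[unfolded One_nat_def])
      then show ?thesis using 2 by simp
    qed
  qed
  have "s ` ?H = {i2, sw}"
  proof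
    show "s ` ?H \<subseteq> {i2, sw}" using s by blast
    obtain h where "h \<in> ?H" "h B = C" using quot_vertex_trans[OF BC(2,3)] by blast
    then have "sw \<in> s ` ?H" using s[of h] BC(1) by auto
    moreover obtain h where "h \<in> ?H" "h B = B" using quot_vertex_trans[OF BC(2,2)] by blast
    then have "i2 \<in> s ` ?H" using s[of h] BC(1) by auto
    ultimately show "{i2, sw} \<subseteq> s ` ?H" by simp
  qed
  then have "rotations 2 = (\<lambda>g. \<lambda>y\<in>{..<2}. f (g (inv_into V f y))) ` ?H"
    unfolding rot s_def by simp
  then have "pair_iso V F ?H {..<2} (complete_edges 2) (rotations 2)"
    unfolding pair_iso_def using f_bij edges by blast
  moreover have "orbits_form_bipartition X E N"
    unfolding orbits_form_bipartition_def
  proof (rule exI[of _ B], rule exI[of _ C], intro conjI ballI V BC(1))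
    fix e assume e: "e \<in> E"
    then obtain x y where xy: "e = {x, y}" using edge_pair by blast
    then have xyX: "x \<in> X" "y \<in> X" using edge_in e by blast+
    have "orb N x \<in> {B, C}" "orb N y \<in> {B, C}" "orb N x \<noteq> orb N y"
      using orb_vert[OF xyX(1)] orb_vert[OF xyX(2)] noloop[of x y] e xy V by simp_all
    then have "x \<in> B \<and> y \<in> C \<or> y \<in> B \<and> x \<in> C"
      using orb_self[OF xyX(1)] orb_self[OF xyX(2)] by fastforce
    then show "\<exists>x\<in>B. \<exists>y\<in>C. e = {x, y}"
      unfolding xy by (metis insert_commute)
  qed
  ultimately show ?thesis by (simp add: degenerate_quotient_def Let_def)
qed

text \<open>Supplies the rotation for \<open>cycle_rotation\<close>. It is enough to follow an arc
  from \<open>a\<close> to \<open>b\<close> by an arc from \<open>b\<close> to some \<open>e\<close>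
  outside the orbit of \<open>a\<close>, since an element taking the first arc to the second does
  not turn back.\<close>

lemma ex_turning:
  assumes noloop: "\<And>x y. {x, y} \<in> E \<Longrightarrow> orb N x \<noteq> orb N y"
    and two: "regular_graph V F 2"
  obtains B h where "B \<in> V" "h \<in> quot_group X G N" "{B, h B} \<in> F" "h (h B) \<noteq> B"
proof -
  obtain a b where ab: "(a, b) \<in> D" using ex_arc by blast
  then have abX: "a \<in> X" "b \<in> X" and abE: "{a, b} \<in> E" using D_in edge_iff by auto
  have "card {C \<in> V. {orb N b, C} \<in> F} = 2"
    using two orb_vert[OF abX(2)] by (simp add: regular_graph_def)
  \<comment> \<open>Valency 2 provides an orbit adjacent to that of \<open>b\<close> other than the
    orbit of \<open>a\<close>; the edge to it may however be directed into \<open>b\<close>.\<close>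
  then have "\<not> {C \<in> V. {orb N b, C} \<in> F} \<subseteq> {orb N a}"
    using card_mono[of "{orb N a}" "{C \<in> V. {orb N b, C} \<in> F}"] by auto
  then obtain C where C: "{orb N b, C} \<in> F" "C \<noteq> orb N a" by blast
  then obtain c where c: "{b, c} \<in> E" "orb N c \<noteq> orb N a"
    unfolding qedge_iff[OF abX(2)] by blast
  have "\<exists>e. (b, e) \<in> D \<and> orb N e \<noteq> orb N a"
  proof (cases "(b, c) \<in> D")
    case True
    then show ?thesis using c by blast
  next
    case False
    then have cb: "(c, b) \<in> D" using c edge_iff by blast
    obtain d where d: "(b, d) \<in> D" using ex_out[OF abX(2)] by blast
    show ?thesis
    proof (cases "orb N d = orb N a")
      case True
      \<comment> \<open>This \<open>g\<close> fixes \<open>b\<close> and takes the orbit of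
        \<open>a\<close> to that of \<open>c\<close>; it redirects the arc from \<open>b\<close> to
        \<open>d\<close> into the orbit of \<open>c\<close>.\<close>
      obtain g where g: "g \<in> G" "g a = c" "g b = b" using arc_trans[OF ab cb] by blast
      have "(b, g d) \<in> D" using arc_closed[OF g(1) d] g(3) by simp
      moreover have "orb N (g d) = orb N c"
        using image_orb[OF g(1), of d] image_orb[OF g(1) abX(1)] D_in[OF d] True g(2) by simp
      ultimately show ?thesis using c(2) by (intro exI[of _ "g d"]) simp
    qed (use d in blast)
  qed
  then obtain e where e: "(b, e) \<in> D" "orb N e \<noteq> orb N a" by blast
  obtain g where g: "g \<in> G" "g a = b" "g b = e" using arc_trans[OF ab e(1)] by blast
  have "{orb N a, orb N b} \<in> F"
    using noloop[OF abE] abE unfolding qedge_iff[OF abX(1)] by metis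
  then show thesis
    using that[of "orb N a" "qact g"] g abX e(2) by (simp add: quot_group_eq)
qed

lemma degenerate_cycle:
  assumes noloop: "\<And>x y. {x, y} \<in> E \<Longrightarrow> orb N x \<noteq> orb N y"
    and two: "regular_graph V F 2" and mult: "normal_multicover 2 X E N"
  shows "degenerate_quotient X E G N"
proof -
  obtain B h where Bh: "B \<in> V" "h \<in> quot_group X G N" "{B, h B} \<in> F" "h (h B) \<noteq> B"
    using ex_turning[OF noloop two] by blast
  interpret C: cycle_rotation V "quot_group X G N" F B h
  proof
    show "finite V" "connected_graph V F" "regular_graph V F 2"
      by (rule finV conn_quot two)+
    show "B \<in> V" "h \<in> quot_group X G N" "{B, h B} \<in> F" "h (h B) \<noteq> B" by (rule Bh)+
    show "R \<in> V \<and> S \<in> V \<and> R \<noteq> S" if "{R, S} \<in> F" for R S using that by (rule F_in)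
    show "\<exists>R S. e = {R, S}" if "e \<in> F" for e using that by (rule F_pair)
    show "{g R, g S} \<in> F" if "g \<in> quot_group X G N" "{R, S} \<in> F" for g R S
      using that by (rule quot_edge_closed)
  qed
  show ?thesis
    using C.pair_iso_cycle mult unfolding degenerate_quotient_def Let_def by blast
qed

theorem degenerate_if_not_locally_injective:
  assumes "\<not> locally_injective E N"
  shows "degenerate_quotient X E G N"
proof (cases "\<exists>x y. {x, y} \<in> E \<and> orb N x = orb N y")
  case True
  then obtain x y where "{x, y} \<in> E" "orb N x = orb N y" by blast
  then have "V = {orb N x}" by (rule loop_imp_single)
  then show ?thesis by (rule degenerate_single)
next
  case False
  then have noloop: "\<And>x y. {x, y} \<in> E \<Longrightarrow> orb N x \<noteq> orb N y" by blast
  obtain l where l: "normal_multicover l X E N" using ex_multicover by blast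
  obtain k where k: "l * k = 4" "regular_graph V F k" using multicover_valency[OF noloop l] by blast
  obtain x y z where xyz: "{x, y} \<in> E" "{x, z} \<in> E" "orb N y = orb N z" "y \<noteq> z"
    using assms unfolding locally_injective_def by blast
  have X: "x \<in> X" "y \<in> X" "z \<in> X" using edge_in xyz(1,2) by blast+
  have "{orb N x, orb N y} \<in> F"
    using noloop[OF xyz(1)] xyz(1) unfolding qedge_iff[OF X(1)] by metis
  then have "card {w \<in> orb N y. {x, w} \<in> E} = l"
    using l orb_self[OF X(1)] unfolding normal_multicover_def by blast
  moreover have "{y, z} \<subseteq> {w \<in> orb N y. {x, w} \<in> E}"
    using xyz orb_self[OF X(2)] orb_self[OF X(3)] by simp
  moreover have "finite {w \<in> orb N y. {x, w} \<in> E}"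
    using finite_vert[OF orb_vert[OF X(2)]] by simp
  ultimately have "l \<ge> 2"
    using card_mono[of "{w \<in> orb N y. {x, w} \<in> E}" "{y, z}"] xyz(4) by simp
  have "k \<noteq> 0" using k(1) by (cases k) auto
  \<comment> \<open>Two distinct neighbours in one orbit gave \<open>l\<close> at least 2, so
    \<open>l * k = 4\<close> leaves only valencies 1 and 2.\<close>
  have "k \<le> 2"
  proof (rule ccontr)
    assume "\<not> k \<le> 2"
    then have "l * k \<ge> 2 * 3" using \<open>l \<ge> 2\<close> by (intro mult_le_mono) auto
    then show False using k(1) by simp
  qed
  then have "k = 1 \<or> k = 2" using \<open>k \<noteq> 0\<close> by auto
  then show ?thesis
  proof
    assume "k = 1"
    then show ?thesis using degenerate_K2[OF noloop] k(2) by blast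
  next
    assume "k = 2"
    \<comment> \<open>The equation also determines \<open>l\<close>, which yields the multicover
      condition of the cycle case.\<close>
    moreover from this have "l = 2" using k(1) by simp
    ultimately show ?thesis using degenerate_cycle[OF noloop] k(2) l by blast
  qed
qed

end

section \<open>Locally injective subgroups and covers\<close>

context og4_normal
begin

lemma F_arcE:
  assumes "e \<in> F"
  obtains x y where "(x, y) \<in> D" "e = {orb N x, orb N y}"
proof -
  obtain B C where e: "e = {B, C}" using F_pair assms by blast
  obtain x y where xy: "B = orb N x" "C = orb N y" "{x, y} \<in> E"
    by (rule qedge_orbE[OF assms[unfolded e]]) (rule that)
  from xy(3) consider "(x, y) \<in> D" | "(y, x) \<in> D" using edge_iff by blast
  then show thesis
  proof cases
    case 1
    then show thesis using that e xy by blast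
  next
    case 2
    then show thesis using that[OF 2] e xy by (simp add: insert_commute)
  qed
qed

lemma mod_carrier: "carrier (perm_group X G Mod N) = {N #>\<^bsub>perm_group X G\<^esub> g | g. g \<in> G}"
  by (auto simp: FactGroup_def RCOSETS_def)

text \<open>All elements of the coset act alike on the orbits, since \<open>N\<close> fixes each
  orbit. The union in \<open>coset_action\<close> is thus one of equal sets, and it is not empty
  because \<open>N\<close> contains the identity.\<close>

lemma coset_action_rcoset:
  assumes g: "g \<in> G"
  shows "coset_action X N (N #>\<^bsub>perm_group X G\<^esub> g) = qact g"
  unfolding coset_action_def qact_def
proof (rule restrict_ext)
  fix B assume "B \<in> V"
  then obtain x where x: "x \<in> X" "B = orb N x" by (rule vertE)
  have coset: "N #>\<^bsub>perm_group X G\<^esub> g = (\<lambda>n. compose X n g) ` N"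
    unfolding r_coset_def using g by (auto simp: mult_perm)
  have "compose X n g ` B = g ` B" if "n \<in> N" for n
  proof -
    have "compose X n g ` orb N x = orb N (n (g x))"
      using image_orb[OF compose_in[OF N_in_G[OF that] g] x(1)] x(1) by (simp add: compose_def)
    then show ?thesis using image_orb[OF g x(1)] that g x by simp
  qed
  then have "(\<Union>c\<in>(\<lambda>n. compose X n g) ` N. c ` B) = (\<Union>n\<in>N. g ` B)" by simp
  also have "\<dots> = g ` B" using N.id_in by blast
  finally show "(\<Union>c\<in>N #>\<^bsub>perm_group X G\<^esub> g. c ` B) = g ` B" unfolding coset .
qed

context
  assumes linj: "locally_injective E N"
begin

lemma locally_injectiveD: "{x, y} \<in> E \<Longrightarrow> {x, z} \<in> E \<Longrightarrow> orb N y = orb N z \<Longrightarrow> y = z"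
  using linj unfolding locally_injective_def by blast

text \<open>Otherwise there is a single orbit, and local injectivity leaves \<open>x\<close> with
  one neighbour instead of four.\<close>

lemma locally_injective_noloop:
  assumes "{x, y} \<in> E"
  shows "orb N x \<noteq> orb N y"
proof
  assume "orb N x = orb N y"
  then have V: "V = {orb N x}" by (rule loop_imp_single[OF assms])
  have "orb N u = orb N w" if "u \<in> X" "w \<in> X" for u w
    using orb_vert[OF that(1)] orb_vert[OF that(2)] unfolding V by simp
  then have "u = w" if "{x, u} \<in> E" "{x, w} \<in> E" for u w
    using locally_injectiveD[OF that] edge_in that by metis
  then have "{w \<in> X. {x, w} \<in> E} \<subseteq> {y}" using assms by blast
  moreover have "card {w \<in> X. {x, w} \<in> E} = 4"
    using val4 edge_in[OF assms] by (simp add: regular_graph_def)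
  ultimately show False using card_mono[of "{y}" "{w \<in> X. {x, w} \<in> E}"] by simp
qed

lemma qedge_orb: "{x, y} \<in> E \<Longrightarrow> {orb N x, orb N y} \<in> F"
proof -
  assume xy: "{x, y} \<in> E"
  then have "x \<in> X" using edge_in by blast
  then show ?thesis
    using xy locally_injective_noloop[OF xy] unfolding qedge_iff[OF \<open>x \<in> X\<close>] by metis
qed

lemma multicover_1: "normal_multicover 1 X E N"
proof -
  obtain l where l: "normal_multicover l X E N" using ex_multicover by blast
  obtain a b where "(a, b) \<in> D" using ex_arc by blast
  then have ab: "a \<in> X" "b \<in> X" "{a, b} \<in> E" using D_in edge_iff by auto
  have "w = b" if "w \<in> orb N b" "{a, w} \<in> E" for w
    using locally_injectiveD[OF that(2) ab(3)] orb_eq[OF that(1) ab(2)] by blast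
  then have "{w \<in> orb N b. {a, w} \<in> E} = {b}" using ab(3) orb_self[OF ab(2)] by blast
  moreover have "card {w \<in> orb N b. {a, w} \<in> E} = l"
    using l qedge_orb[OF ab(3)] orb_self[OF ab(1)] unfolding normal_multicover_def by blast
  ultimately show ?thesis using l by simp
qed

lemma quot_val4: "regular_graph V F 4"
  using multicover_valency[OF locally_injective_noloop multicover_1] by simp

text \<open>The arcs of the quotient are the projections of those in \<open>D\<close>; they form one
  orbit of the induced group because \<open>D\<close> is one of \<open>G\<close>.\<close>

lemma quot_oriented: "oriented_graph V F (quot_group X G N)"
proof -
  define D' where "D' = (\<lambda>(x, y). (orb N x, orb N y)) ` D"
  have D': "(B, C) \<in> D' \<longleftrightarrow> (\<exists>x y. (x, y) \<in> D \<and> B = orb N x \<and> C = orb N y)" for B C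
    unfolding D'_def by auto
  obtain a b where ab: "a \<in> X" "b \<in> X" "\<And>x y. (x, y) \<in> D \<longleftrightarrow> (\<exists>g\<in>G. x = g a \<and> y = g b)"
    by (rule base_arc) (rule that)
  have "D' = orbit (perm_group V (quot_group X G N)) (\<lambda>g. map_prod g g) (orb N a, orb N b)"
  proof (intro equalityI subsetI)
    fix p assume "p \<in> D'"
    then obtain x y where xy: "(x, y) \<in> D" "p = (orb N x, orb N y)"
      unfolding D'_def by (elim imageE) (auto split: prod.splits)
    then obtain g where g: "g \<in> G" "x = g a" "y = g b" unfolding ab(3) by (elim bexE conjE)
    have "p = map_prod (qact g) (qact g) (orb N a, orb N b)" using xy(2) g ab(1,2) by simp
    moreover have "qact g \<in> quot_group X G N" using g(1) by (simp add: quot_group_eq)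
    ultimately show "p \<in> orbit (perm_group V (quot_group X G N)) (\<lambda>g. map_prod g g) (orb N a, orb N b)"
      unfolding orbit_def Q.carrier_perm mem_Collect_eq by (intro exI conjI)
  next
    fix p assume "p \<in> orbit (perm_group V (quot_group X G N)) (\<lambda>g. map_prod g g) (orb N a, orb N b)"
    then obtain h where h: "h \<in> quot_group X G N" "p = map_prod h h (orb N a, orb N b)"
      unfolding orbit_def Q.carrier_perm mem_Collect_eq by (elim exE conjE)
    then obtain g where g: "g \<in> G" "h = qact g" unfolding quot_group_eq by (elim imageE)
    have "p = (orb N (g a), orb N (g b))" using h(2) g ab(1,2) by simp
    moreover have "(g a, g b) \<in> D" unfolding ab(3) using g(1) by (intro bexI[of _ g]) simp_all
    ultimately show "p \<in> D'" using D' by auto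
  qed
  then have "D' \<in> orbits (perm_group V (quot_group X G N)) (V \<times> V) (\<lambda>g. map_prod g g)"
    unfolding orbits_def mem_Collect_eq using orb_vert[OF ab(1)] orb_vert[OF ab(2)]
    by (intro exI[of _ "(orb N a, orb N b)"]) simp
  moreover have "D' \<inter> D'\<inverse> = {}"
  proof -
    have False if BC: "(B, C) \<in> D'" "(C, B) \<in> D'" for B C
    proof -
      obtain x y where xy: "(x, y) \<in> D" "B = orb N x" "C = orb N y" using BC(1) unfolding D' by (elim exE conjE)
      obtain y' x' where yx: "(y', x') \<in> D" "C = orb N y'" "B = orb N x'" using BC(2) unfolding D' by (elim exE conjE)
      have X: "x \<in> X" "x' \<in> X" "y' \<in> X" using D_in[OF xy(1)] D_in[OF yx(1)] by simp_all
      have "orb N x = orb N x'" using xy(2) yx(3) by simp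
      \<comment> \<open>Moved by \<open>n\<close>, the second arc ends at \<open>x\<close>. Then
        \<open>y\<close> and \<open>n y'\<close> are neighbours of \<open>x\<close> in one orbit,
        hence equal, and \<open>D\<close> would contain an arc together with its reverse.\<close>
      then obtain n where n: "n \<in> N" "x = n x'"
        using orb_eqD[OF X(2) X(1)] by blast
      have arc: "(n y', x) \<in> D" using arc_closed[OF N_in_G[OF n(1)] yx(1)] n(2) by simp
      then have "{x, y} \<in> E" "{x, n y'} \<in> E" using xy(1) unfolding edge_iff by blast+
      moreover have "orb N y = orb N (n y')" using orb_n[OF n(1) X(3)] xy(3) yx(2) by simp
      ultimately have "y = n y'" by (rule locally_injectiveD)
      then show False using arc xy(1) D_antisym by blast
    qed
    then show ?thesis by blast
  qed
  moreover have "F = {{B, C} | B C. (B, C) \<in> D' \<or> (C, B) \<in> D'}"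
  proof (intro equalityI subsetI)
    fix e assume "e \<in> F"
    then obtain x y where "(x, y) \<in> D" "e = {orb N x, orb N y}" by (rule F_arcE)
    moreover from this have "(orb N x, orb N y) \<in> D'" 
      unfolding D' by blast
    ultimately show "e \<in> {{B, C} | B C. (B, C) \<in> D' \<or> (C, B) \<in> D'}" by blast
  next
    fix e assume "e \<in> {{B, C} | B C. (B, C) \<in> D' \<or> (C, B) \<in> D'}"
    then obtain B C where BC: "e = {B, C}" "(B, C) \<in> D'"
      using insert_commute by blast
    then obtain x y where xy: "(x, y) \<in> D" "B = orb N x" "C = orb N y"
      unfolding D' by (elim exE conjE)
    then have "{x, y} \<in> E" using edge_iff by blast
    then show "e \<in> F" unfolding BC(1) xy(2,3) by (rule qedge_orb)
  qed
  ultimately show ?thesis unfolding oriented_graph_def by blast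
qed

lemma quot_OG4: "OG4 V F (quot_group X G N)"
  unfolding OG4_def
proof (intro conjI simple_quot conn_quot quot_val4 quot_oriented Q.subgroup_Bij)
  show "quot_group X G N \<subseteq> graph_aut V F"
  proof
    fix h assume h: "h \<in> quot_group X G N"
    \<comment> \<open>The inverse also preserves edges, which gives the converse
      implication.\<close>
    obtain k where k: "k \<in> quot_group X G N" "\<And>B. B \<in> V \<Longrightarrow> k (h B) = B"
      by (rule Q.ex_inv[OF h]) (rule that)
    have "{h B, h C} \<in> F \<longleftrightarrow> {B, C} \<in> F" if "B \<in> V" "C \<in> V" for B C
    proof
      assume "{h B, h C} \<in> F"
      then have "{k (h B), k (h C)} \<in> F" by (rule quot_edge_closed[OF k(1)])
      then show "{B, C} \<in> F" using k(2) that by simp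
    qed (rule quot_edge_closed[OF h])
    then show "h \<in> graph_aut V F"
      unfolding graph_aut_def using Q.in_Bij[OF h] by (intro CollectI conjI ballI)
  qed
  show "\<forall>B\<in>V. \<forall>C\<in>V. \<exists>h\<in>quot_group X G N. h B = C"
    by (intro ballI quot_vertex_trans)
  show "\<forall>e\<in>F. \<forall>f\<in>F. \<exists>h\<in>quot_group X G N. h ` e = f"
  proof (intro ballI)
    fix e f assume "e \<in> F" "f \<in> F"
    obtain x y where xy: "(x, y) \<in> D" "e = {orb N x, orb N y}" using \<open>e \<in> F\<close> by (rule F_arcE)
    obtain u w where uw: "(u, w) \<in> D" "f = {orb N u, orb N w}" using \<open>f \<in> F\<close> by (rule F_arcE)
    obtain g where g: "g \<in> G" "g x = u" "g y = w"
      by (rule arc_trans[OF xy(1) uw(1)]) (rule that)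
    have "qact g ` e = f"
      unfolding xy(2) uw(2) using g D_in[OF xy(1)] by simp
    moreover have "qact g \<in> quot_group X G N" using g(1) by (simp add: quot_group_eq)
    ultimately show "\<exists>h\<in>quot_group X G N. h ` e = f" by (rule bexI)
  qed
qed

text \<open>The kernel of the action on orbits is no larger than \<open>N\<close>. Agreement of
  \<open>g\<close> with \<open>n\<close> spreads along edges: the two images of a neighbour are
  adjacent to a common vertex and lie in the same orbit.\<close>

lemma fixes_orbits_imp_in_N:
  assumes g: "g \<in> G" and fix_orbs: "\<And>x. x \<in> X \<Longrightarrow> orb N (g x) = orb N x"
  shows "g \<in> N"
proof -
  obtain x0 where x0: "x0 \<in> X" using conn unfolding connected_graph_def by blast
  obtain n where n: "n \<in> N" "g x0 = n x0"
    using orb_eqD[OF x0 closed[OF g x0] fix_orbs[OF x0]] by (elim bexE)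
  have "X \<subseteq> {x. g x = n x}"
  proof (rule connected_closed[OF conn x0])
    show "x0 \<in> {x. g x = n x}" using n(2) by simp
    fix x y assume x: "x \<in> {x. g x = n x}" and xy: "{x, y} \<in> E"
    have yX: "y \<in> X" using edge_in[OF xy] by simp
    have "{g x, g y} \<in> E" "{g x, n y} \<in> E"
      using edge_closed[OF g xy] edge_closed[OF N_in_G[OF n(1)] xy] x by simp_all
    moreover have "orb N (g y) = orb N (n y)" using fix_orbs[OF yX] orb_n[OF n(1) yX] by simp
    ultimately show "y \<in> {x. g x = n x}" using locally_injectiveD[of "g x" "g y" "n y"] by simp
  qed
  then have "g = n" by (intro ext g N_in_G n(1)) blast
  then show ?thesis using n(1) by simp
qed

lemma quot_faithful:
  "faithful_action (perm_group X G Mod N) V (coset_action X N)"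
proof -
  let ?P = "perm_group X G"
  have hom: "coset_action X N \<in> hom (?P Mod N) (BijGroup V)"
  proof (rule homI)
    fix c assume "c \<in> carrier (?P Mod N)"
    then obtain g where "g \<in> G" "c = N #>\<^bsub>?P\<^esub> g" unfolding mod_carrier by blast
    then show "coset_action X N c \<in> carrier (BijGroup V)"
      using coset_action_rcoset[of g] qact_Bij[of g] by (simp add: BijGroup_def)
  next
    fix c d assume "c \<in> carrier (?P Mod N)" "d \<in> carrier (?P Mod N)"
    then obtain g h where g: "g \<in> G" "c = N #>\<^bsub>?P\<^esub> g" and h: "h \<in> G" "d = N #>\<^bsub>?P\<^esub> h"
      unfolding mod_carrier by blast
    have "c \<otimes>\<^bsub>?P Mod N\<^esub> d = N #>\<^bsub>?P\<^esub> compose X g h"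
      using normal.rcos_sum[OF normal, of g h] g h by (simp add: FactGroup_def mult_perm)
    then have "coset_action X N (c \<otimes>\<^bsub>?P Mod N\<^esub> d) = qact (compose X g h)"
      using coset_action_rcoset compose_in g(1) h(1) by simp
    also have "\<dots> = qact g \<otimes>\<^bsub>BijGroup V\<^esub> qact h"
      using qact_compose[OF g(1) h(1)] qact_Bij[OF g(1)] qact_Bij[OF h(1)] by (simp add: BijGroup_def)
    finally show "coset_action X N (c \<otimes>\<^bsub>?P Mod N\<^esub> d) =
        coset_action X N c \<otimes>\<^bsub>BijGroup V\<^esub> coset_action X N d"
      using coset_action_rcoset g h by simp
  qed
  have "inj_on (coset_action X N) (carrier (?P Mod N))"
  proof (rule inj_onI)
    fix c d assume "c \<in> carrier (?P Mod N)" "d \<in> carrier (?P Mod N)"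
      and eq: "coset_action X N c = coset_action X N d"
    then obtain g h where g: "g \<in> G" "c = N #>\<^bsub>?P\<^esub> g" and h: "h \<in> G" "d = N #>\<^bsub>?P\<^esub> h"
      unfolding mod_carrier by blast
    have qeq: "qact g = qact h" using eq coset_action_rcoset g h by simp
    obtain h' where h': "h' \<in> G" "\<And>x. x \<in> X \<Longrightarrow> h' (h x) = x" "\<And>x. x \<in> X \<Longrightarrow> h (h' x) = x"
      by (rule ex_inv[OF h(1)]) (rule that)
    \<comment> \<open>This is \<open>g\<close> times the inverse of \<open>h\<close>; it fixes every
      orbit because \<open>g\<close> and \<open>h\<close> induce the same map.\<close>
    have k: "compose X g h' \<in> N"
    proof (rule fixes_orbits_imp_in_N[OF compose_in[OF g(1) h'(1)]])
      fix x assume x: "x \<in> X"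
      then have "orb N (g (h' x)) = orb N (h (h' x))"
        using fun_cong[OF qeq, of "orb N (h' x)"] g(1) h(1) h'(1) by simp
      then show "orb N (compose X g h' x) = orb N x" using x h'(3) by (simp add: compose_def)
    qed
    have "g = compose X (compose X g h') h"
    proof (rule ext[OF g(1) compose_in[OF N_in_G[OF k] h(1)]])
      fix x assume "x \<in> X"
      then show "g x = compose X (compose X g h') h x" using h(1) h'(2) by (simp add: compose_def)
    qed
    then have "g = compose X g h' \<otimes>\<^bsub>?P\<^esub> h" using mult_perm[OF N_in_G[OF k] h(1)] by simp
    then have "g \<in> N #>\<^bsub>?P\<^esub> h" unfolding r_coset_def using k by blast
    then show "c = d"
      using group.repr_independence[OF group_perm _ _ normal_imp_subgroup[OF normal], of g h] h(1) g(2) h(2)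
      by simp
  qed
  with hom show ?thesis
    by (intro faithful_action.intro group_action.intro group_hom.intro group_hom_axioms.intro
        faithful_action_axioms.intro normal.factorgroup_is_group[OF normal] group_BijGroup)
qed

theorem cover_if_locally_injective: "normal_cover X E N" "quotient_in_OG4 X E G N"
  using multicover_1 quot_OG4 quot_faithful by (simp_all add: normal_cover_def quotient_in_OG4_def)

end

end

section \<open>Preimages of normal subgroups of the induced group\<close>

lemma (in og4_normal) preimage_normal:
  assumes M: "M \<lhd> perm_group V (quot_group X G N)"
  shows "normal_perm X G {g \<in> G. qact g \<in> M}"
proof -
  interpret M: normal_perm V "quot_group X G N" M
    by (intro normal_perm.intro normal_perm_axioms.intro M Q.perm_grp_axioms)
  have *: "perm_grp X {g \<in> G. qact g \<in> M}"
  proof (rule perm_grpI)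
    show "{g \<in> G. qact g \<in> M} \<subseteq> Bij X" using in_Bij by blast
    show "(\<lambda>x\<in>X. x) \<in> {g \<in> G. qact g \<in> M}" using id_in M.N.id_in qact_id by simp
    show "compose X g h \<in> {g \<in> G. qact g \<in> M}"
      if "g \<in> {g \<in> G. qact g \<in> M}" "h \<in> {g \<in> G. qact g \<in> M}" for g h
      using that compose_in M.N.compose_in qact_compose by simp
  next
    fix g assume g: "g \<in> {g \<in> G. qact g \<in> M}"
    then have gG: "g \<in> G" and gM: "qact g \<in> M" by simp_all
    obtain k where k: "k \<in> G" "\<And>x. x \<in> X \<Longrightarrow> k (g x) = x" "\<And>x. x \<in> X \<Longrightarrow> g (k x) = x"
      by (rule ex_inv[OF gG]) (rule that)
    obtain m where m: "m \<in> M" "\<And>B. B \<in> V \<Longrightarrow> m (qact g B) = B"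
      by (rule M.N.ex_inv[OF gM]) (rule that)
    \<comment> \<open>The inverse of \<open>qact g\<close> found in \<open>M\<close> is induced by
      \<open>k\<close>, so \<open>k\<close> lies in the preimage.\<close>
    have "qact k = m"
    proof (rule Q.ext)
      show "qact k \<in> quot_group X G N" using k(1) by (simp add: quot_group_eq)
      show "m \<in> quot_group X G N" using m(1) by simp
      fix B assume "B \<in> V"
      then obtain x where x: "x \<in> X" "B = orb N x" by (rule vertE)
      have "m (orb N (g (k x))) = orb N (k x)"
        using m(2)[of "orb N (k x)"] gG k(1) x(1) by simp
      then show "qact k B = m B" using k(1,3) x by simp
    qed
    then show "\<exists>k\<in>{g \<in> G. qact g \<in> M}. \<forall>x\<in>X. k (g x) = x"
      using k m(1) by (intro bexI[of _ k]) simp_all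
  qed
  show ?thesis
  proof (rule normal_permI[OF *])
    fix g n assume g: "g \<in> G" and n: "n \<in> {g \<in> G. qact g \<in> M}"
    then have nG: "n \<in> G" and nM: "qact n \<in> M" by simp_all
    obtain k where k: "k \<in> G" "\<And>x. x \<in> X \<Longrightarrow> k (g x) = x" "\<And>x. x \<in> X \<Longrightarrow> g (k x) = x"
      by (rule ex_inv[OF g]) (rule that)
    have qg: "qact g \<in> quot_group X G N" using g by (simp add: quot_group_eq)
    obtain m where m: "m \<in> M" "\<And>B. B \<in> V \<Longrightarrow> m (qact g B) = qact g (qact n B)"
      by (rule M.conj[OF qg nM]) (rule that)
    \<comment> \<open>The conjugate of \<open>n\<close> by \<open>g\<close>; it induces the
      conjugate \<open>m\<close> of \<open>qact n\<close>, which lies in \<open>M\<close>.\<close>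
    let ?c = "compose X (compose X g n) k"
    have c: "?c \<in> G" using g nG k(1) compose_in by simp
    have c_eq: "?c x = g (n (k x))" if "x \<in> X" for x
      using that k(1) by (simp add: compose_def)
    have "qact ?c = m"
    proof (rule Q.ext)
      show "qact ?c \<in> quot_group X G N" using c by (simp add: quot_group_eq)
      show "m \<in> quot_group X G N" using m(1) by simp
      fix B assume "B \<in> V"
      then obtain x where x: "x \<in> X" "B = orb N x" by (rule vertE)
      have "m (orb N (g (k x))) = orb N (g (n (k x)))"
        using m(2)[of "orb N (k x)"] g nG k(1) x(1) by simp
      then show "qact ?c B = m B" using c c_eq k(3) x by simp
    qed
    then have "?c \<in> {g \<in> G. qact g \<in> M}" using c m(1) by simp
    moreover have "\<forall>x\<in>X. ?c (g x) = g (n x)" using c_eq k(2) g by simp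
    ultimately show "\<exists>m\<in>{g \<in> G. qact g \<in> M}. \<forall>x\<in>X. m (g x) = g (n x)"
      by (intro bexI[of _ ?c])
  qed blast
qed

text \<open>Local injectivity is used twice. If \<open>y\<close> and \<open>z\<close> share an orbit
  of the preimage, their \<open>N\<close>-orbits share an \<open>M\<close>-orbit and are adjacent to
  that of \<open>x\<close>, so they coincide; then \<open>y = z\<close> because \<open>N\<close> is
  locally injective.\<close>

lemma (in og4_normal) preimage_locally_injective:
  assumes linj: "locally_injective E N"
    and M: "M \<lhd> perm_group V (quot_group X G N)" and linjM: "locally_injective F M"
  shows "locally_injective E {g \<in> G. qact g \<in> M}"
proof -
  interpret M: normal_perm V "quot_group X G N" M
    by (intro normal_perm.intro normal_perm_axioms.intro M Q.perm_grp_axioms)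
  \<comment> \<open>kept opaque, since \<open>M'.N_in_G\<close> would loop on a set comprehension\<close>
  define M' where "M' = {g \<in> G. qact g \<in> M}"
  have qM: "qact g \<in> M" if "g \<in> M'" for g using that by (simp add: M'_def)
  interpret M': normal_perm X G M' unfolding M'_def by (rule preimage_normal[OF M])
  have "y = z" if xy: "{x, y} \<in> E" and xz: "{x, z} \<in> E" and eq: "orb M' y = orb M' z" for x y z
  proof -
    have X: "y \<in> X" "z \<in> X" using edge_in[OF xy] edge_in[OF xz] by simp_all
    obtain g where g: "g \<in> M'" "y = g z"
      using M'.orb_eqD[OF X(2,1) eq] by (elim bexE)
    have "orb N y = qact g (orb N z)" unfolding g(2) using M'.N_in_G[OF g(1)] X(2) by simp
    then have "orb M (orb N y) = orb M (orb N z)"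
      using M.orb_n[OF qM[OF g(1)] orb_vert[OF X(2)]] by simp
    then have "orb N y = orb N z"
      using linjM qedge_orb[OF linj xy] qedge_orb[OF linj xz]
      unfolding locally_injective_def by blast
    then show "y = z" by (rule locally_injectiveD[OF linj xy xz])
  qed
  then show ?thesis unfolding locally_injective_def M'_def by blast
qed

text \<open>Elements of \<open>N\<close> induce the identity and so lie in the preimage; a
  nonidentity element of \<open>M\<close> is induced by an element outside \<open>N\<close>.\<close>

lemma (in og4_normal) preimage_proper:
  assumes M: "M \<lhd> perm_group V (quot_group X G N)"
    and nontriv: "M \<noteq> {\<one>\<^bsub>perm_group V (quot_group X G N)\<^esub>}"
  shows "N \<subset> {g \<in> G. qact g \<in> M}"
proof -
  interpret M: normal_perm V "quot_group X G N" M
    by (intro normal_perm.intro normal_perm_axioms.intro M Q.perm_grp_axioms)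
  have N_triv: "qact n = (\<lambda>B\<in>V. B)" if "n \<in> N" for n
    unfolding qact_id[symmetric]
    by (rule qact_ext) (use that id_in in simp_all)
  then have "N \<subseteq> {g \<in> G. qact g \<in> M}" using M.N.id_in by auto
  moreover obtain m where m: "m \<in> M" "m \<noteq> (\<lambda>B\<in>V. B)"
    using nontriv M.N.id_in unfolding Q.one_perm by blast
  then obtain g where "g \<in> G" "m = qact g"
    using M.N_in_G[OF m(1)] unfolding quot_group_eq by (elim imageE)
  then have "g \<in> {g \<in> G. qact g \<in> M}" "g \<notin> N" using m N_triv by auto
  ultimately show ?thesis by blast
qed

section \<open>A locally injective normal subgroup of maximal order\<close>

theorem lemma3p3:
  fixes X :: "'a set" and E :: "'a set set" and G :: "('a \<Rightarrow> 'a) set"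
  assumes "OG4 X E G"
    and "\<not> basic_pair X E G"
  shows "\<exists>N. N \<lhd> perm_group X G \<and>
             normal_cover X E N \<and>
             quotient_in_OG4 X E G N \<and>
             basic_pair (quot_verts X N) (quot_edges X E N) (quot_group X G N)"
proof -
  let ?P = "perm_group X G"
  obtain D where "og4 X G E D" using OG4_imp_og4[OF assms(1)] .
  then interpret og4 X G E D .
  define S where "S = {N. N \<lhd> ?P \<and> locally_injective E N}"
  have og4_normal: "og4_normal X G E D N" if "N \<lhd> ?P" for N
    by (intro og4_normal.intro normal_perm.intro normal_perm_axioms.intro that
        perm_grp_axioms og4_axioms)
  have "N \<subseteq> G" if "N \<in> S" for N
    using subgroup.subset[OF normal_imp_subgroup, of N ?P] that by (simp add: S_def)
  then have "S \<subseteq> Pow G" by blast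
  then have fin: "finite S" by (rule finite_subset) (simp add: finite_grp finX)
  \<comment> \<open>Failure to be basic yields a subgroup with a non-degenerate quotient; it shows
    that \<open>S\<close> is not empty.\<close>
  obtain N0 where N0: "N0 \<lhd> ?P" "\<not> degenerate_quotient X E G N0"
    using assms unfolding basic_pair_def by blast
  then have "N0 \<in> S"
    using og4_normal.degenerate_if_not_locally_injective[OF og4_normal[OF N0(1)]]
    unfolding S_def by blast
  then obtain N where "N \<in> S" and card_N: "card N = Max (card ` S)"
    using fin by (metis (no_types, lifting) empty_iff obtains_MAX)
  then have N: "N \<lhd> ?P" "locally_injective E N" by (simp_all add: S_def)
  interpret N: og4_normal X G E D N by (rule og4_normal[OF N(1)])
  note cover = N.cover_if_locally_injective[OF N(2)]
  let ?V = "quot_verts X N" and ?F = "quot_edges X E N" and ?H = "quot_group X G N"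
  have quot: "OG4 ?V ?F ?H" by (rule N.quot_OG4[OF N(2)])
  have "degenerate_quotient ?V ?F ?H M"
    if M: "M \<lhd> perm_group ?V ?H" and nontriv: "M \<noteq> {\<one>\<^bsub>perm_group ?V ?H\<^esub>}" for M
  proof (rule ccontr)
    assume nondeg: "\<not> degenerate_quotient ?V ?F ?H M"
    \<comment> \<open>The quotient pair has an orientation of its own, so the same dichotomy applies
      to \<open>M\<close> acting on the orbits.\<close>
    obtain D' where D': "og4 ?V ?H ?F D'" using OG4_imp_og4[OF quot] .
    have "og4_normal ?V ?H ?F D' M"
      by (intro og4_normal.intro normal_perm.intro normal_perm_axioms.intro M
          N.Q.perm_grp_axioms D')
    then have linjM: "locally_injective ?F M"
      using og4_normal.degenerate_if_not_locally_injective nondeg by blast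
    let ?M' = "{g \<in> G. N.qact g \<in> M}"
    have "?M' \<in> S"
      using normal_perm.normal[OF N.preimage_normal[OF M]]
        N.preimage_locally_injective[OF N(2) M linjM] by (simp add: S_def)
    \<comment> \<open>The preimage competes with \<open>N\<close> in \<open>S\<close>, yet contains
      it properly, against the choice of \<open>N\<close>.\<close>
    then have "card ?M' \<le> card N" unfolding card_N using fin by simp
    moreover have "card N < card ?M'"
      by (rule psubset_card_mono[OF _ N.preimage_proper[OF M nontriv]])
        (simp add: finite_grp finX)
    ultimately show False by simp
  qed
  then have "basic_pair ?V ?F ?H" using quot by (simp add: basic_pair_def)
  then show ?thesis using N(1) cover by blast
qed

end
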